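(* Let $(S,X_1,X_2,Y)$ be a discrete memoryless source on finite alphabets $\mathcal{S}\times\mathcal{X}_1\times\mathcal{X}_2\times\mathcal{Y}$ with joint pmf of the form $p(x_1,x_2,y)\,p(s|x_1)$, and let $R(D_1,D_2,D_s)$ be the associated rate-distortion function (defined in the context). If $X_1-Y-X_2$ forms a Markov chain, then $$R(D_1,D_2,D_s)=R_{\mathrm{2d},X_1|Y}(D_1,D_s)+R_{X_2|Y}(D_2),$$ where $$R_{\mathrm{2d},X_1|Y}(D_1,D_s)=\min_{\substack{p(\hat x_1,\hat s|x_1,y):\\ \mathbb E d_1(X_1,\hat X_1)\le D_1\\ \mathbb E d_s'(X_1,\hat S)\le D_s}} I(X_1;\hat X_1,\hat S|Y),\qquad R_{X_2|Y}(D_2)=\min_{\substack{p(\hat x_2|x_2,y):\\ \mathbb E d_2(X_2,\hat X_2)\le D_2}} I(X_2;\hat X_2|Y),$$ and $d_s'(x_1,\hat s)=\frac{1}{p(x_1)}\sum_{s\in\mathcal S}p(x_1,s)\,d_s(s,\hat s)$.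
   Context: Let $(S_i,X_{1,i},X_{2,i},Y_i)$, $i=1,2,\dots$, be i.i.d. copies of $(S,X_1,X_2,Y)$. Let $\hat{\mathcal X}_1,\hat{\mathcal X}_2,\hat{\mathcal S}$ be finite reconstruction alphabets and let $d_1:\mathcal X_1\times\hat{\mathcal X}_1\to[0,\infty)$, $d_2:\mathcal X_2\times\hat{\mathcal X}_2\to[0,\infty)$, $d_s:\mathcal S\times\hat{\mathcal S}\to[0,\infty)$ be bounded. For sequences, $d_1(x_1^n,\hat x_1^n)=\frac1n\sum_{i=1}^n d_1(x_{1,i},\hat x_{1,i})$, and similarly for $d_2$ and $d_s$. An $(n,2^{nR})$ code consists of an encoding function $\mathcal X_1^n\times\mathcal X_2^n\times\mathcal Y^n\to\{1,2,\dots,2^{nR}\}$ and a decoding function $\{1,2,\dots,2^{nR}\}\times\mathcal Y^n\to\hat{\mathcal X}_1^n\times\hat{\mathcal X}_2^n\times\hat{\mathcal S}^n$, producing $(\hat X_1^n,\hat X_2^n,\hat S^n)$. A nonnegative tuple $(R,D_1,D_2,D_s)$ is achievable if for all sufficiently large $n$ there exist $(n,2^{nR})$ codes such that $\lim_{n\to\infty}\mathbb E d_1(X_1^n,\hat X_1^n)\le D_1$, $\lim_{n\to\infty}\mathbb E d_2(X_2^n,\hat X_2^n)\le D_2$ and $\lim_{n\to\infty}\mathbb E d_s(S^n,\hat S^n)\le D_s$. The rate-distortion function $R(D_1,D_2,D_s)$ is the infimum of all $R$ such that $(R,D_1,D_2,D_s)$ is achievable. The paper shows that it equals the minimum of $I(X_1,X_2;\hat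 X_1,\hat X_2,\hat S|Y)$ over conditional pmfs $p(\hat x_1,\hat x_2,\hat s|x_1,x_2,y)$ with $\mathbb E d_1(X_1,\hat X_1)\le D_1$, $\mathbb E d_2(X_2,\hat X_2)\le D_2$, $\mathbb E d_s'(X_1,\hat S)\le D_s$. Logarithms are base 2; symbols $x_1$ with $p(x_1)=0$ may be disregarded; an infimum/minimum over an empty set is $+\infty$. *)

theory Defs
  imports "HOL-Probability.Probability"
begin

fun S_of :: "'s \<times> 'x1 \<times> 'x2 \<times> 'y \<Rightarrow> 's" where
  "S_of (s, x1, x2, y) = s"

fun X1_of :: "'s \<times> 'x1 \<times> 'x2 \<times> 'y \<Rightarrow> 'x1" where
  "X1_of (s, x1, x2, y) = x1"

fun X2_of :: "'s \<times> 'x1 \<times> 'x2 \<times> 'y \<Rightarrow> 'x2" where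
  "X2_of (s, x1, x2, y) = x2"

fun Y_of :: "'s \<times> 'x1 \<times> 'x2 \<times> 'y \<Rightarrow> 'y" where
  "Y_of (s, x1, x2, y) = y"

definition factorizes :: "('s \<times> 'x1 \<times> 'x2 \<times> 'y) pmf \<Rightarrow> bool" where
  "factorizes P \<longleftrightarrow>
     (\<exists>W :: 'x1 \<Rightarrow> 's pmf. \<forall>s x1 x2 y.
        pmf P (s, x1, x2, y)
          = pmf (map_pmf (\<lambda>w. (X1_of w, X2_of w, Y_of w)) P) (x1, x2, y) * pmf (W x1) s)"

text \<open>
  No positivity condition on \<open>B = b\<close> is needed below: if that event has probability zero,
  all three conditional probabilities are zero, because division by zero yields zero.
\<close>

definition markov_chain :: "'w pmf \<Rightarrow> ('w \<Rightarrow> 'a) \<Rightarrow> ('w \<Rightarrow> 'b) \<Rightarrow> ('w \<Rightarrow> 'c) \<Rightarrow> bool" where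
  "markov_chain P A B C \<longleftrightarrow>
     (\<forall>a b c. \<P>(w in measure_pmf P. A w = a \<and> C w = c \<bar> B w = b)
            = \<P>(w in measure_pmf P. A w = a \<bar> B w = b) * \<P>(w in measure_pmf P. C w = c \<bar> B w = b))"

definition cond_mutual_info :: "'w pmf \<Rightarrow> ('w \<Rightarrow> 'a) \<Rightarrow> ('w \<Rightarrow> 'b) \<Rightarrow> ('w \<Rightarrow> 'c) \<Rightarrow> real" where
  "cond_mutual_info P A B C =
     prob_space.conditional_mutual_information (measure_pmf P) 2
       (count_space (range A)) (count_space (range B)) (count_space (range C)) A B C"

definition seqs :: "nat \<Rightarrow> 'a list set" where
  "seqs n = {xs. length xs = n}"

definition seq_dist :: "('x \<Rightarrow> 'a \<Rightarrow> real) \<Rightarrow> nat \<Rightarrow> 'x list \<Rightarrow> 'a list \<Rightarrow> real" where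
  "seq_dist d n xs as = (\<Sum>i<n. d (xs ! i) (as ! i)) / real n"

text \<open>\<open>2 powr (n * R)\<close> need not be an integer; the messages are the integers in \<open>[1, 2 powr (n * R)]\<close>.\<close>

definition messages :: "nat \<Rightarrow> real \<Rightarrow> nat set" where
  "messages n R = {1..nat \<lfloor>2 powr (real n * R)\<rfloor>}"

type_synonym ('x1, 'x2, 'y) encoder = "'x1 list \<times> 'x2 list \<times> 'y list \<Rightarrow> nat"
type_synonym ('y, 'a1, 'a2, 'b) decoder = "nat \<times> 'y list \<Rightarrow> 'a1 list \<times> 'a2 list \<times> 'b list"

definition is_code ::
  "nat \<Rightarrow> real \<Rightarrow> ('x1, 'x2, 'y) encoder \<Rightarrow> ('y, 'a1, 'a2, 'b) decoder \<Rightarrow> bool" where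
  "is_code n R enc dec \<longleftrightarrow>
     enc \<in> seqs n \<times> seqs n \<times> seqs n \<rightarrow> messages n R \<and>
     dec \<in> messages n R \<times> seqs n \<rightarrow> seqs n \<times> seqs n \<times> seqs n"

definition reconstruct ::
  "('x1, 'x2, 'y) encoder \<Rightarrow> ('y, 'a1, 'a2, 'b) decoder \<Rightarrow> ('s \<times> 'x1 \<times> 'x2 \<times> 'y) list
     \<Rightarrow> 'a1 list \<times> 'a2 list \<times> 'b list" where
  "reconstruct enc dec ws =
     dec (enc (map X1_of ws, map X2_of ws, map Y_of ws), map Y_of ws)"

text \<open>
  \<open>replicate_pmf n P\<close> is the law of the first \<open>n\<close> terms of the i.i.d. source.
  The values of \<open>enc n\<close> and \<open>dec n\<close> for the finitely many \<open>n\<close> at which they need not form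
  a code have no influence on the limits.
\<close>

definition achievable ::
  "('s \<times> 'x1 \<times> 'x2 \<times> 'y) pmf \<Rightarrow> ('x1 \<Rightarrow> 'a1 \<Rightarrow> real) \<Rightarrow> ('x2 \<Rightarrow> 'a2 \<Rightarrow> real) \<Rightarrow> ('s \<Rightarrow> 'b \<Rightarrow> real)
     \<Rightarrow> real \<Rightarrow> real \<Rightarrow> real \<Rightarrow> real \<Rightarrow> bool" where
  "achievable P d1 d2 ds R D1 D2 Ds \<longleftrightarrow>
     0 \<le> R \<and> 0 \<le> D1 \<and> 0 \<le> D2 \<and> 0 \<le> Ds \<and>
     (\<exists>(enc :: nat \<Rightarrow> ('x1, 'x2, 'y) encoder) (dec :: nat \<Rightarrow> ('y, 'a1, 'a2, 'b) decoder) L1 L2 Ls.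
        (\<forall>\<^sub>F n in sequentially. is_code n R (enc n) (dec n)) \<and>
        (\<lambda>n. measure_pmf.expectation (replicate_pmf n P) (\<lambda>ws.
           case reconstruct (enc n) (dec n) ws of (as1, as2, bs) \<Rightarrow>
             seq_dist d1 n (map X1_of ws) as1)) \<longlonglongrightarrow> L1 \<and> L1 \<le> D1 \<and>
        (\<lambda>n. measure_pmf.expectation (replicate_pmf n P) (\<lambda>ws.
           case reconstruct (enc n) (dec n) ws of (as1, as2, bs) \<Rightarrow>
             seq_dist d2 n (map X2_of ws) as2)) \<longlonglongrightarrow> L2 \<and> L2 \<le> D2 \<and>
        (\<lambda>n. measure_pmf.expectation (replicate_pmf n P) (\<lambda>ws.
           case reconstruct (enc n) (dec n) ws of (as1, as2, bs) \<Rightarrow>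
             seq_dist ds n (map S_of ws) bs)) \<longlonglongrightarrow> Ls \<and> Ls \<le> Ds)"

definition rate_distortion ::
  "('s \<times> 'x1 \<times> 'x2 \<times> 'y) pmf \<Rightarrow> ('x1 \<Rightarrow> 'a1 \<Rightarrow> real) \<Rightarrow> ('x2 \<Rightarrow> 'a2 \<Rightarrow> real) \<Rightarrow> ('s \<Rightarrow> 'b \<Rightarrow> real)
     \<Rightarrow> real \<Rightarrow> real \<Rightarrow> real \<Rightarrow> ereal" where
  "rate_distortion P d1 d2 ds D1 D2 Ds = (INF R \<in> {R. achievable P d1 d2 ds R D1 D2 Ds}. ereal R)"

text \<open>
  A genuine minimum: if a nonempty \<open>V\<close> has no least element, \<open>LEAST\<close> is unspecified, so nothing
  can be concluded from an equation about \<open>min_or_inf V\<close> without the minimum being attained.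
\<close>

definition min_or_inf :: "real set \<Rightarrow> ereal" where
  "min_or_inf V = (if V = {} then \<infinity> else ereal (LEAST v. v \<in> V))"

definition ds' :: "('s :: finite \<times> 'x1 \<times> 'x2 \<times> 'y) pmf \<Rightarrow> ('s \<Rightarrow> 'b \<Rightarrow> real) \<Rightarrow> 'x1 \<Rightarrow> 'b \<Rightarrow> real" where
  "ds' P ds x1 b =
     1 / pmf (map_pmf X1_of P) x1 *
       (\<Sum>s\<in>UNIV. pmf (map_pmf (\<lambda>w. (X1_of w, S_of w)) P) (x1, s) * ds s b)"

definition test_joint :: "'u pmf \<Rightarrow> ('u \<Rightarrow> 'v pmf) \<Rightarrow> ('u \<times> 'v) pmf" where
  "test_joint p W = bind_pmf p (\<lambda>u. map_pmf (Pair u) (W u))"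

definition R_2d ::
  "('s :: finite \<times> 'x1 \<times> 'x2 \<times> 'y) pmf \<Rightarrow> ('x1 \<Rightarrow> 'a1 \<Rightarrow> real) \<Rightarrow> ('s \<Rightarrow> 'b \<Rightarrow> real)
     \<Rightarrow> real \<Rightarrow> real \<Rightarrow> ereal" where
  "R_2d P d1 ds D1 Ds = min_or_inf
     {cond_mutual_info J (\<lambda>((x1, y), (a1, b)). x1) (\<lambda>((x1, y), (a1, b)). (a1, b)) (\<lambda>((x1, y), (a1, b)). y) | J.
        (\<exists>W :: 'x1 \<times> 'y \<Rightarrow> ('a1 \<times> 'b) pmf. J = test_joint (map_pmf (\<lambda>w. (X1_of w, Y_of w)) P) W) \<and>
        measure_pmf.expectation J (\<lambda>((x1, y), (a1, b)). d1 x1 a1) \<le> D1 \<and>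
        measure_pmf.expectation J (\<lambda>((x1, y), (a1, b)). ds' P ds x1 b) \<le> Ds}"

definition R_X2 ::
  "('s \<times> 'x1 \<times> 'x2 \<times> 'y) pmf \<Rightarrow> ('x2 \<Rightarrow> 'a2 \<Rightarrow> real) \<Rightarrow> real \<Rightarrow> ereal" where
  "R_X2 P d2 D2 = min_or_inf
     {cond_mutual_info J (\<lambda>((x2, y), a2). x2) (\<lambda>((x2, y), a2). a2) (\<lambda>((x2, y), a2). y) | J.
        (\<exists>W :: 'x2 \<times> 'y \<Rightarrow> 'a2 pmf. J = test_joint (map_pmf (\<lambda>w. (X2_of w, Y_of w)) P) W) \<and>
        measure_pmf.expectation J (\<lambda>((x2, y), a2). d2 x2 a2) \<le> D2}"

end

theory Submission
  imports Defs
begin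

text \<open>
  Achievability: for each side-information word, the codebook is chosen greedily, one word at a time,
  so that the mass of uncovered source words is at most the average for i.i.d. codewords drawn from
  the output marginals. Asking typicality to control the information density and the three
  distortions to within \<open>n powr (- 1 / 4)\<close>, Chebyshev's inequality makes the expected distortions
  converge to the single-letter ones.

  Converse: let \<open>J1\<close> and \<open>J2\<close> be the time averages over the block of the joint laws of source
  letters and reconstructions. By the Markov chain the product of the two ratios posterior over prior
  is a conditional likelihood ratio, and \<open>ln x \<le> x - 1\<close>, applied to its product over the block,
  gives \<open>I(J1) + I(J2) \<le> R\<close> for every code. Compactness of the set of pmfs on a finite type and
  continuity of the conditional mutual information carry this to the limit, and also show that the
  two minima are attained.
\<close>

text \<open>The converse has to split one quantity belonging to a joint code for x1 and x2 into two.
  It does so letter by letter: the chain condition turns p(x1,x2,y) times both ratios into p(y)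
  times a product of a posterior of x1 and a posterior of x2, and the sum over (x1, x2) factors into
  two sums that are at most 1.

  A reconstruction letter depends on the whole block, so the letter laws change with the position.
  \<open>J1\<close> and \<open>J2\<close> are therefore formed from the code first, and their ratios
  are then used unchanged at every position; the expected sum of logarithms is exactly n * (I(J1) +
  I(J2)).

  Neither encoder nor decoder sees the letters of S. As S is drawn from x1 alone, conditioning on
  the rest of the source replaces \<open>ds\<close> by its conditional mean \<open>ds'\<close>, and
  every distortion becomes a linear functional of the averaged law of (x1, x2, y) and its
  reconstruction. Linear constraints are what lets feasibility survive limits.\<close>

section \<open>Product laws on lists\<close>

abbreviation "E p f \<equiv> measure_pmf.expectation p f"

lemma expectation_bind_pmf_finite:
  fixes h :: "'b \<Rightarrow> real"
  assumes "finite (set_pmf p)" "\<And>x. x \<in> set_pmf p \<Longrightarrow> finite (set_pmf (f x))"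
  shows "E (bind_pmf p f) h = E p (\<lambda>x. E (f x) h)"
  using assms by (subst pmf_expectation_bind[of "set_pmf p"])
    (auto simp: integral_measure_pmf[of "set_pmf p"])

lemma expectation_finite_sum:
  fixes f :: "'a :: finite \<Rightarrow> real"
  shows "E p f = (\<Sum>x\<in>UNIV. pmf p x * f x)"
  by (subst integral_measure_pmf[of UNIV]) auto

lemma expectation_mono_finite:
  fixes f g :: "'a \<Rightarrow> real"
  assumes "finite (set_pmf p)" "\<And>x. x \<in> set_pmf p \<Longrightarrow> f x \<le> g x"
  shows "E p f \<le> E p g"
  using assms by (intro integral_mono_AE integrable_measure_pmf_finite) (auto simp: AE_measure_pmf_iff)

lemma expectation_cong_set_pmf:
  fixes f g :: "'a \<Rightarrow> real"
  assumes "\<And>x. x \<in> set_pmf p \<Longrightarrow> f x = g x"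
  shows "E p f = E p g"
  using assms by (intro integral_cong_AE) (auto simp: AE_measure_pmf_iff)

lemma ex_le_expectation:
  fixes f :: "'a \<Rightarrow> real"
  assumes "finite (set_pmf p)"
  shows "\<exists>x\<in>set_pmf p. f x \<le> E p f"
proof (rule ccontr)
  assume "\<not> ?thesis"
  then have *: "\<And>x. x \<in> set_pmf p \<Longrightarrow> E p f < f x" by auto
  have "E p f < E p f"
    using assms * by (intro measure_pmf.expectation_greater integrable_measure_pmf_finite)
      (auto simp: AE_measure_pmf_iff)
  then show False by simp
qed

text \<open>\<open>replicate_pmf\<close> has equal factors only. Given a source word, the output
  letters are independent, but their laws vary along the word, as in
  \<open>list_pmf (map W vs)\<close>.\<close>

primrec list_pmf :: "'a pmf list \<Rightarrow> 'a list pmf" where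
  "list_pmf [] = return_pmf []"
| "list_pmf (p # ps) = bind_pmf p (\<lambda>x. map_pmf (Cons x) (list_pmf ps))"

lemma replicate_pmf_Suc_map: "replicate_pmf (Suc n) p = bind_pmf p (\<lambda>x. map_pmf (Cons x) (replicate_pmf n p))"
  by (simp add: map_pmf_def)

lemma replicate_pmf_eq_list_pmf: "replicate_pmf n p = list_pmf (replicate n p)"
  by (induction n) (simp_all add: map_pmf_def)

lemma length_of_set_list_pmf: "xs \<in> set_pmf (list_pmf ps) \<Longrightarrow> length xs = length ps"
  by (induction ps arbitrary: xs) auto

lemma length_of_set_replicate_pmf: "xs \<in> set_pmf (replicate_pmf n p) \<Longrightarrow> length xs = n"
  by (simp add: set_replicate_pmf)

lemma pmf_bind_Cons: "pmf (bind_pmf p (\<lambda>x. map_pmf (Cons x) Q)) (y # ys) = pmf p y * pmf Q ys"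
proof -
  have "bind_pmf p (\<lambda>x. map_pmf (Cons x) Q) = map_pmf (\<lambda>(x, xs). x # xs) (pair_pmf p Q)"
    by (simp add: pair_pmf_def map_pmf_def bind_assoc_pmf bind_return_pmf)
  then have "pmf (bind_pmf p (\<lambda>x. map_pmf (Cons x) Q)) (y # ys) =
     pmf (map_pmf (\<lambda>(x, xs). x # xs) (pair_pmf p Q)) ((\<lambda>(x, xs). x # xs) (y, ys))" by simp
  also have "\<dots> = pmf (pair_pmf p Q) (y, ys)" by (rule pmf_map_inj') (auto simp: inj_on_def)
  finally show ?thesis by (simp add: pmf_pair)
qed

lemma pmf_replicate_pmf_Cons: "pmf (replicate_pmf (Suc n) p) (x # xs) = pmf p x * pmf (replicate_pmf n p) xs"
  by (simp add: replicate_pmf_eq_list_pmf pmf_bind_Cons)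

lemma finite_lists_length: "finite {xs :: 'a :: finite list. length xs = n}"
  using finite_lists_length_eq[of "UNIV :: 'a set" n] by simp

lemma finite_set_list_pmf: "finite (set_pmf (list_pmf (ps :: 'a :: finite pmf list)))"
  by (rule finite_subset[OF _ finite_lists_length]) (auto dest: length_of_set_list_pmf)

lemma finite_set_replicate_pmf: "finite (set_pmf (replicate_pmf n (p :: 'a :: finite pmf)))"
  by (simp add: replicate_pmf_eq_list_pmf finite_set_list_pmf)

lemma map_replicate_pmf: "map_pmf (map f) (replicate_pmf n p) = replicate_pmf n (map_pmf f p)"
proof (induction n)
  case (Suc n)
  then show ?case
    by (simp add: replicate_pmf_Suc_map map_bind_pmf bind_map_pmf pmf.map_comp o_def
        flip: Suc.IH del: replicate_pmf.simps)
qed simp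

lemma expectation_replicate_Suc:
  fixes h :: "'a :: finite list \<Rightarrow> real"
  shows "E (replicate_pmf (Suc n) p) h = E p (\<lambda>x. E (replicate_pmf n p) (\<lambda>xs. h (x # xs)))"
  unfolding replicate_pmf_Suc_map
  by (subst expectation_bind_pmf_finite) (auto simp: finite_set_replicate_pmf)

lemma expectation_replicate_sum_list:
  fixes g :: "'a :: finite \<Rightarrow> real"
  shows "E (replicate_pmf n p) (\<lambda>ws. \<Sum>w\<leftarrow>ws. g w) = n * E p g"
proof (induction n)
  case (Suc n)
  have "E (replicate_pmf (Suc n) p) (\<lambda>ws. \<Sum>w\<leftarrow>ws. g w) = E p (\<lambda>x. g x + n * E p g)"
    by (simp add: expectation_replicate_Suc integrable_measure_pmf_finite finite_set_replicate_pmf Suc.IH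
        del: replicate_pmf.simps)
  also have "\<dots> = Suc n * E p g"
    by (simp add: integrable_measure_pmf_finite algebra_simps)
  finally show ?case .
qed simp

text \<open>Head and tail of the list are independent, so the cross term of the expanded square
  contains the factor \<open>E p g\<close> and vanishes.\<close>

lemma expectation_replicate_sum_list_square:
  fixes g :: "'a :: finite \<Rightarrow> real"
  assumes "E p g = 0"
  shows "E (replicate_pmf n p) (\<lambda>ws. (\<Sum>w\<leftarrow>ws. g w)\<^sup>2) = n * E p (\<lambda>x. (g x)\<^sup>2)"
proof (induction n)
  case (Suc n)
  have "E (replicate_pmf (Suc n) p) (\<lambda>ws. (\<Sum>w\<leftarrow>ws. g w)\<^sup>2)
      = E p (\<lambda>x. E (replicate_pmf n p) (\<lambda>ws. (g x)\<^sup>2 + 2 * g x * (\<Sum>w\<leftarrow>ws. g w) + (\<Sum>w\<leftarrow>ws. g w)\<^sup>2))"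
    by (simp add: expectation_replicate_Suc power2_sum algebra_simps del: replicate_pmf.simps)
  also have "\<dots> = E p (\<lambda>x. (g x)\<^sup>2 + 2 * g x * (n * E p g) + n * E p (\<lambda>x. (g x)\<^sup>2))"
    by (simp add: integrable_measure_pmf_finite finite_set_replicate_pmf Suc.IH expectation_replicate_sum_list)
  also have "\<dots> = Suc n * E p (\<lambda>x. (g x)\<^sup>2)"
    by (simp add: integrable_measure_pmf_finite assms algebra_simps)
  finally show ?case .
qed simp

text \<open>Chebyshev's inequality: (n \<epsilon>)^2 times the indicator of the bad event is
  dominated pointwise by the squared centred sum. The bad event is a negated \<le> to fit the
  complement of \<open>jointly_typical\<close>.\<close>

lemma weak_law_replicate_pmf:
  fixes f :: "'a :: finite \<Rightarrow> real"
  assumes "n > 0" "\<epsilon> > 0"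
  shows "measure_pmf.prob (replicate_pmf n p) {ws. \<not> \<bar>(\<Sum>w\<leftarrow>ws. f w) - n * E p f\<bar> \<le> n * \<epsilon>}
     \<le> E p (\<lambda>x. (f x - E p f)\<^sup>2) / (n * \<epsilon>\<^sup>2)"
proof -
  let ?g = "\<lambda>x. f x - E p f"
  let ?B = "{ws. \<not> \<bar>(\<Sum>w\<leftarrow>ws. f w) - n * E p f\<bar> \<le> n * \<epsilon>}"
  have s: "(\<Sum>w\<leftarrow>ws. ?g w) = (\<Sum>w\<leftarrow>ws. f w) - length ws * E p f" for ws
    by (induction ws) (auto simp: algebra_simps)
  have z: "E p ?g = 0" by (simp add: integrable_measure_pmf_finite)
  have "(n * \<epsilon>)\<^sup>2 * measure_pmf.prob (replicate_pmf n p) ?B = E (replicate_pmf n p) (\<lambda>ws. (n*\<epsilon>)\<^sup>2 * indicator ?B ws)"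
    by simp
  also have "\<dots> \<le> E (replicate_pmf n p) (\<lambda>ws. (\<Sum>w\<leftarrow>ws. ?g w)\<^sup>2)"
  proof (rule expectation_mono_finite[OF finite_set_replicate_pmf])
    fix ws assume "ws \<in> set_pmf (replicate_pmf n p)"
    then have l: "length ws = n" by (rule length_of_set_replicate_pmf)
    show "(n*\<epsilon>)\<^sup>2 * indicator ?B ws \<le> (\<Sum>w\<leftarrow>ws. ?g w)\<^sup>2"
      using assms by (auto simp: indicator_def s l abs_le_square_iff[symmetric] simp del: power_mult_distrib)
  qed
  also have "\<dots> = n * E p (\<lambda>x. (?g x)\<^sup>2)" by (rule expectation_replicate_sum_list_square[OF z])
  finally show ?thesis using assms by (simp add: field_simps power2_eq_square)
qed

text \<open>Random coding by the method of conditional expectations. Under \<open>M\<close>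
  independent draws from \<open>Q\<close>, \<open>v\<close> stays uncovered with probability
  \<open>(1 - measure_pmf.prob Q (T v)) ^ M\<close>, so the right-hand side is the expected
  uncovered weight. Each word is chosen so that the expectation over the words still to be drawn
  does not increase.\<close>

lemma greedy_codebook:
  fixes w :: "'v \<Rightarrow> real" and Q :: "'a pmf"
  assumes "finite (set_pmf Q)" "\<And>v. 0 \<le> w v"
  shows "\<exists>cs. length cs = M \<and> set cs \<subseteq> set_pmf Q \<and>
    (\<Sum>v\<in>V. w v * of_bool (\<forall>c\<in>set cs. c \<notin> T v)) \<le> (\<Sum>v\<in>V. w v * (1 - measure_pmf.prob Q (T v)) ^ M)"
  using assms(2)
proof (induction M arbitrary: w)
  case (Suc M)
  \<comment> \<open>\<open>?f c\<close> is the expected uncovered weight when \<open>c\<close> is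
    the first word and the other \<open>M\<close> words are random.\<close>
  let ?f = "\<lambda>c. \<Sum>v\<in>V. w v * (1 - measure_pmf.prob Q (T v)) ^ M * indicator (- T v) c"
  obtain c where c: "c \<in> set_pmf Q" "?f c \<le> E Q ?f"
    using ex_le_expectation[OF assms(1), of ?f] by blast
  have 1: "measure_pmf.prob Q (- T v) = 1 - measure_pmf.prob Q (T v)" for v
    using measure_pmf.prob_compl[of "T v" Q] by (simp add: Compl_eq_Diff_UNIV)
  have E: "E Q ?f = (\<Sum>v\<in>V. w v * (1 - measure_pmf.prob Q (T v)) ^ Suc M)"
    by (subst Bochner_Integration.integral_sum)
       (auto simp: integrable_measure_pmf_finite[OF assms(1)] 1 mult_ac)
  \<comment> \<open>The induction continues with weight only on the points that \<open>c\<close>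
    missed; this is why \<open>w\<close> is generalised.\<close>
  define w' where "w' v = w v * indicator (- T v) c" for v
  obtain cs where cs: "length cs = M" "set cs \<subseteq> set_pmf Q"
    "(\<Sum>v\<in>V. w' v * of_bool (\<forall>c\<in>set cs. c \<notin> T v)) \<le> (\<Sum>v\<in>V. w' v * (1 - measure_pmf.prob Q (T v)) ^ M)"
    using Suc.IH[of w'] Suc.prems by (auto simp: w'_def)
  have "(\<Sum>v\<in>V. w v * of_bool (\<forall>c\<in>set (c # cs). c \<notin> T v)) = (\<Sum>v\<in>V. w' v * of_bool (\<forall>c\<in>set cs. c \<notin> T v))"
    by (intro sum.cong) (auto simp: w'_def indicator_def)
  also have "\<dots> \<le> ?f c" using cs(3) by (simp add: w'_def mult_ac)
  also note c(2) 
  also note E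
  finally show ?case using cs(1,2) c(1) by (intro exI[of _ "c # cs"]) auto
qed simp

section \<open>Covering codebooks\<close>

text \<open>By independence the remaining source letters may be drawn before the first output
  letter. This separates a block of pairs into a source word and, given it, independent output
  letters; it serves the test channel in the covering argument and the hidden letters in
  \<open>expectation_source\<close>.\<close>

lemma replicate_pmf_test_joint:
  "replicate_pmf n (test_joint p W) =
    bind_pmf (replicate_pmf n p) (\<lambda>vs. map_pmf (zip vs) (list_pmf (map W vs)))"
proof (induction n)
  case (Suc n)
  have "replicate_pmf (Suc n) (test_joint p W) =
      bind_pmf p (\<lambda>v. bind_pmf (W v) (\<lambda>a. bind_pmf (replicate_pmf n p)
        (\<lambda>vs. map_pmf (\<lambda>as. (v, a) # zip vs as) (list_pmf (map W vs)))))"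
    unfolding replicate_pmf_Suc_map Suc.IH
    by (simp add: test_joint_def bind_assoc_pmf bind_map_pmf map_bind_pmf pmf.map_comp o_def)
  also have "\<dots> = bind_pmf p (\<lambda>v. bind_pmf (replicate_pmf n p) (\<lambda>vs. bind_pmf (W v)
        (\<lambda>a. map_pmf (\<lambda>as. (v, a) # zip vs as) (list_pmf (map W vs)))))"
    by (subst bind_commute_pmf) simp
  also have "\<dots> = bind_pmf (replicate_pmf (Suc n) p) (\<lambda>vs. map_pmf (zip vs) (list_pmf (map W vs)))"
    unfolding replicate_pmf_Suc_map
    by (simp add: bind_assoc_pmf bind_map_pmf map_bind_pmf pmf.map_comp o_def)
  finally show ?case .
qed (simp add: map_pmf_def bind_return_pmf)

lemma pmf_test_joint: "pmf (test_joint p W) (u, a) = pmf p u * pmf (W u) a"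
proof -
  have "pmf (test_joint p W) (u, a) = (\<integral>v. pmf (W u) a * indicator {u} v \<partial>measure_pmf p)"
    unfolding test_joint_def pmf_bind
  proof (intro Bochner_Integration.integral_cong refl)
    fix v
    show "pmf (map_pmf (Pair v) (W v)) (u, a) = pmf (W u) a * indicator {u} v"
    proof (cases "v = u")
      case True
      have "pmf (map_pmf (Pair u) (W u)) (u, a) = pmf (W u) a"
        by (rule pmf_map_inj') (auto simp: inj_on_def)
      with True show ?thesis by simp
    next
      case False
      then have "(u, a) \<notin> set_pmf (map_pmf (Pair v) (W v))" by auto
      then have "pmf (map_pmf (Pair v) (W v)) (u, a) = 0" by (simp only: set_pmf_iff not_not)
      with False show ?thesis by simp
    qed
  qed
  also have "\<dots> = pmf p u * pmf (W u) a"
    by (simp add: measure_pmf_single mult.commute)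
  finally show ?thesis .
qed

text \<open>Change of measure from the channel law of a word to the codebook law, which sees only
  the side information. The price is the sum of \<open>i\<close>, in the role of the information
  density.\<close>

lemma pmf_list_pmf_le_powr:
  assumes "length as = length vs"
    and "\<And>v a. v \<in> set vs \<Longrightarrow> pmf (W v) a \<le> 2 powr i (v, a) * pmf (q (Y v)) a"
  shows "pmf (list_pmf (map W vs)) as
     \<le> 2 powr (\<Sum>w\<leftarrow>zip vs as. i w) * pmf (list_pmf (map q (map Y vs))) as"
  using assms
proof (induction as vs rule: list_induct2)
  case (Cons a as v vs)
  have "pmf (list_pmf (map W (v # vs))) (a # as) = pmf (W v) a * pmf (list_pmf (map W vs)) as"
    by (simp add: pmf_bind_Cons)
  also have "\<dots> \<le> (2 powr i (v, a) * pmf (q (Y v)) a) *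
      (2 powr (\<Sum>w\<leftarrow>zip vs as. i w) * pmf (list_pmf (map q (map Y vs))) as)"
    using Cons by (intro mult_mono) auto
  also have "\<dots> = 2 powr (\<Sum>w\<leftarrow>zip (v # vs) (a # as). i w) * pmf (list_pmf (map q (map Y (v # vs)))) (a # as)"
    by (simp add: pmf_bind_Cons powr_add)
  finally show ?case .
qed simp

text \<open>Here \<open>w\<close> is the channel probability of the typical words, \<open>l\<close>
  the loss in the change of measure and \<open>M\<close> the codebook size. By 1 - Q \<le> exp (-Q)
  the left side is at most exp (-(M l w)), and convexity bounds this by the chord of
  \<open>exp\<close> between 0 and -(M l), taken at weight \<open>w\<close>.\<close>

lemma one_minus_power_le:
  fixes Q w l :: real
  assumes "0 \<le> w" "w \<le> 1" "0 \<le> l" "l * w \<le> Q" "Q \<le> 1"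
  shows "(1 - Q) ^ M \<le> 1 - w + exp (- (real M * l))"
proof -
  have c: "convex_on UNIV (exp :: real \<Rightarrow> real)" by (rule exp_convex)
  have "exp (- (real M * (l * w))) \<le> 1 - w + w * exp (- (real M * l))"
    using convex_onD[OF c, of w 0 "- (real M * l)"] assms by (simp add: mult_ac)
  also have "w * exp (- (real M * l)) \<le> exp (- (real M * l))" by (intro mult_left_le_one_le) (use assms in auto)
  finally have "exp (- (real M * (l * w))) \<le> 1 - w + exp (- (real M * l))" by simp
  moreover have "(1 - Q) ^ M \<le> exp (- Q) ^ M"
    using assms exp_ge_add_one_self[of "- Q"] by (intro power_mono) auto
  moreover have "exp (- Q) ^ M = exp (- (real M * Q))" by (simp add: exp_of_nat_mult[symmetric])
  moreover have "exp (- (real M * Q)) \<le> exp (- (real M * (l * w)))" using assms by (simp add: mult_left_mono)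
  ultimately show ?thesis by linarith
qed

text \<open>Typicality constrains averages of chosen functions and not the empirical type, so a
  union of Chebyshev bounds estimates its failure.\<close>

definition jointly_typical :: "nat \<Rightarrow> real \<Rightarrow> 'w pmf \<Rightarrow> ('w \<Rightarrow> real) set \<Rightarrow> 'w list set" where
  "jointly_typical n \<epsilon> J F = {ws. \<forall>f\<in>F. \<bar>(\<Sum>w\<leftarrow>ws. f w) - n * E J f\<bar> \<le> n * \<epsilon>}"

lemma prob_not_jointly_typical:
  fixes J :: "'w :: finite pmf"
  assumes "finite F" "n > 0" "\<epsilon> > 0"
  shows "measure_pmf.prob (replicate_pmf n J) (- jointly_typical n \<epsilon> J F)
    \<le> (\<Sum>f\<in>F. E J (\<lambda>w. (f w - E J f)\<^sup>2)) / (n * \<epsilon>\<^sup>2)"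
proof -
  have "- jointly_typical n \<epsilon> J F = (\<Union>f\<in>F. {ws. \<not> \<bar>(\<Sum>w\<leftarrow>ws. f w) - n * E J f\<bar> \<le> n * \<epsilon>})"
    by (auto simp: jointly_typical_def)
  also have "measure_pmf.prob (replicate_pmf n J) \<dots> \<le>
     (\<Sum>f\<in>F. measure_pmf.prob (replicate_pmf n J) {ws. \<not> \<bar>(\<Sum>w\<leftarrow>ws. f w) - n * E J f\<bar> \<le> n * \<epsilon>})"
    using assms by (intro measure_pmf.finite_measure_subadditive_finite) auto
  also have "\<dots> \<le> (\<Sum>f\<in>F. E J (\<lambda>w. (f w - E J f)\<^sup>2) / (n * \<epsilon>\<^sup>2))"
    using assms by (intro sum_mono weak_law_replicate_pmf)
  finally show ?thesis by (simp add: sum_divide_distrib)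
qed

text \<open>The variance term pays for channel outputs that are not typical, the exponential term
  for \<open>M\<close> codewords that all miss the typical ones. The decoder knows
  \<open>ys\<close>, so the greedy choice is made separately on each fibre of source words with the
  same side information.\<close>

lemma covering_codebook:
  fixes p :: "'v :: finite pmf" and W :: "'v \<Rightarrow> 'a :: finite pmf" and q :: "'y :: finite \<Rightarrow> 'a pmf"
    and Y :: "'v \<Rightarrow> 'y" and i :: "'v \<times> 'a \<Rightarrow> real" and M :: nat
  defines "J \<equiv> test_joint p W"
  assumes dom: "\<And>v a. v \<in> set_pmf p \<Longrightarrow> pmf (W v) a \<le> 2 powr i (v, a) * pmf (q (Y v)) a"
    and F: "finite F" "i \<in> F" and n: "n > 0" and \<epsilon>: "\<epsilon> > 0"
  shows "\<exists>c :: 'y list \<Rightarrow> 'a list list. (\<forall>ys. length ys = n \<longrightarrow> length (c ys) = M \<and> (\<forall>as\<in>set (c ys). length as = n)) \<and>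
     measure_pmf.prob (replicate_pmf n p)
       {vs. \<forall>as\<in>set (c (map Y vs)). zip vs as \<notin> jointly_typical n \<epsilon> J F}
     \<le> (\<Sum>f\<in>F. E J (\<lambda>w. (f w - E J f)\<^sup>2)) / (n * \<epsilon>\<^sup>2) + exp (- (real M * 2 powr (- (real n * (E J i + \<epsilon>)))))"
proof -
  let ?T = "\<lambda>vs. {as. length as = n \<and> zip vs as \<in> jointly_typical n \<epsilon> J F}"
  let ?A = "{vs :: 'v list. length vs = n}" and ?B = "{ys :: 'y list. length ys = n}"
  let ?P = "pmf (replicate_pmf n p)"
  let ?Q = "\<lambda>ys. list_pmf (map q ys)"
  let ?l = "2 powr (- (real n * (E J i + \<epsilon>)))"
  have "\<forall>ys. \<exists>cs. length cs = M \<and> set cs \<subseteq> set_pmf (?Q ys) \<and>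
    (\<Sum>vs\<in>{vs\<in>?A. map Y vs = ys}. ?P vs * of_bool (\<forall>c\<in>set cs. c \<notin> ?T vs))
    \<le> (\<Sum>vs\<in>{vs\<in>?A. map Y vs = ys}. ?P vs * (1 - measure_pmf.prob (?Q ys) (?T vs)) ^ M)"
  proof
    fix ys
    show "\<exists>cs. length cs = M \<and> set cs \<subseteq> set_pmf (?Q ys) \<and>
    (\<Sum>vs\<in>{vs\<in>?A. map Y vs = ys}. ?P vs * of_bool (\<forall>c\<in>set cs. c \<notin> ?T vs))
    \<le> (\<Sum>vs\<in>{vs\<in>?A. map Y vs = ys}. ?P vs * (1 - measure_pmf.prob (?Q ys) (?T vs)) ^ M)"
      using greedy_codebook[OF finite_set_list_pmf[of "map q ys"], where w = ?P and M = M and V = "{vs\<in>?A. map Y vs = ys}" and T = ?T]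
      by simp
  qed
  from choice[OF this] obtain c where c: "\<And>ys. length (c ys) = M" "\<And>ys. set (c ys) \<subseteq> set_pmf (?Q ys)"
    "\<And>ys. (\<Sum>vs\<in>{vs\<in>?A. map Y vs = ys}. ?P vs * of_bool (\<forall>c\<in>set (c ys). c \<notin> ?T vs))
    \<le> (\<Sum>vs\<in>{vs\<in>?A. map Y vs = ys}. ?P vs * (1 - measure_pmf.prob (?Q ys) (?T vs)) ^ M)"
    by (elim exE) blast
  have len: "length as = length ys" if "as \<in> set (c ys)" for as ys
    using length_of_set_list_pmf c(2) that by fastforce
  have group: "(\<Sum>vs\<in>?A. h vs) = (\<Sum>ys\<in>?B. \<Sum>vs\<in>{vs\<in>?A. map Y vs = ys}. h vs)" for h :: "'v list \<Rightarrow> real"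
    by (rule sum.group[symmetric]) (auto simp: finite_lists_length)
  let ?w = "\<lambda>vs. measure_pmf.prob (list_pmf (map W vs)) (?T vs)"
  have "measure_pmf.prob (replicate_pmf n p)
       {vs. \<forall>as\<in>set (c (map Y vs)). zip vs as \<notin> jointly_typical n \<epsilon> J F}
     = E (replicate_pmf n p) (\<lambda>vs. indicator {vs. \<forall>as\<in>set (c (map Y vs)). zip vs as \<notin> jointly_typical n \<epsilon> J F} vs)"
    by simp
  also have "\<dots> = (\<Sum>vs\<in>?A. ?P vs * of_bool (\<forall>c\<in>set (c (map Y vs)). c \<notin> ?T vs))"
  proof (subst integral_measure_pmf[of ?A])
    show "(\<Sum>vs\<in>?A. ?P vs *\<^sub>R indicator {vs. \<forall>as\<in>set (c (map Y vs)). zip vs as \<notin> jointly_typical n \<epsilon> J F} vs)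
       = (\<Sum>vs\<in>?A. ?P vs * of_bool (\<forall>c\<in>set (c (map Y vs)). c \<notin> ?T vs))"
    proof (intro sum.cong refl)
      fix vs :: "'v list" assume "vs \<in> ?A"
      then have "(\<forall>as\<in>set (c (map Y vs)). as \<notin> ?T vs) \<longleftrightarrow>
          (\<forall>as\<in>set (c (map Y vs)). zip vs as \<notin> jointly_typical n \<epsilon> J F)"
        by (simp add: len cong: ball_cong)
      then show "?P vs *\<^sub>R indicator {vs. \<forall>as\<in>set (c (map Y vs)). zip vs as \<notin> jointly_typical n \<epsilon> J F} vs
        = ?P vs * of_bool (\<forall>c\<in>set (c (map Y vs)). c \<notin> ?T vs)"
        by (simp add: indicator_def)
    qed
  qed (auto simp: finite_lists_length length_of_set_replicate_pmf)
  also have "\<dots> = (\<Sum>ys\<in>?B. \<Sum>vs\<in>{vs\<in>?A. map Y vs = ys}. ?P vs * of_bool (\<forall>c\<in>set (c ys). c \<notin> ?T vs))"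
    by (subst group) (auto intro!: sum.cong)
  also have "\<dots> \<le> (\<Sum>ys\<in>?B. \<Sum>vs\<in>{vs\<in>?A. map Y vs = ys}. ?P vs * (1 - measure_pmf.prob (?Q ys) (?T vs)) ^ M)"
    by (intro sum_mono c(3))
  also have "\<dots> = (\<Sum>vs\<in>?A. ?P vs * (1 - measure_pmf.prob (?Q (map Y vs)) (?T vs)) ^ M)"
    by (subst group) (auto intro!: sum.cong)
  also have "\<dots> \<le> (\<Sum>vs\<in>?A. ?P vs * (1 - ?w vs + exp (- (real M * ?l))))"
  proof (intro sum_mono)
    fix vs :: "'v list" assume vs: "vs \<in> ?A"
    show "?P vs * (1 - measure_pmf.prob (?Q (map Y vs)) (?T vs)) ^ M \<le> ?P vs * (1 - ?w vs + exp (- (real M * ?l)))"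
    proof (cases "vs \<in> set_pmf (replicate_pmf n p)")
      case False then show ?thesis by (simp add: set_pmf_iff)
    next
      case True
      then have sub: "set vs \<subseteq> set_pmf p" by (auto simp: set_replicate_pmf)
      have fin: "finite (?T vs)" by (rule finite_subset[OF _ finite_lists_length[of n]]) auto
      \<comment> \<open>On typical pairs \<open>i\<close> sums to at most n * (E J i + \<epsilon>),
        so the codebook law gives the typical words at least \<open>?l\<close> times their channel
        probability.\<close>
      have "?l * ?w vs = (\<Sum>as\<in>?T vs. ?l * pmf (list_pmf (map W vs)) as)"
        by (simp add: measure_measure_pmf_finite fin sum_distrib_left)
      also have "\<dots> \<le> (\<Sum>as\<in>?T vs. pmf (?Q (map Y vs)) as)"
      proof (intro sum_mono)
        fix as assume as: "as \<in> ?T vs"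
        have "(\<Sum>w\<leftarrow>zip vs as. i w) \<le> n * (E J i + \<epsilon>)"
          using as F(2) by (auto simp: jointly_typical_def abs_le_iff algebra_simps)
        then have "?l * 2 powr (\<Sum>w\<leftarrow>zip vs as. i w) \<le> 1"
          using powr_mono[of "(\<Sum>w\<leftarrow>zip vs as. i w) - n * (E J i + \<epsilon>)" 0 "2 :: real"]
          by (simp flip: powr_add)
        have "?l * pmf (list_pmf (map W vs)) as
          \<le> ?l * (2 powr (\<Sum>w\<leftarrow>zip vs as. i w) * pmf (?Q (map Y vs)) as)"
          using as vs sub by (intro mult_left_mono pmf_list_pmf_le_powr dom) auto
        also have "\<dots> = (?l * 2 powr (\<Sum>w\<leftarrow>zip vs as. i w)) * pmf (?Q (map Y vs)) as" by (simp only: mult.assoc)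
        also have "\<dots> \<le> pmf (?Q (map Y vs)) as"
          by (intro mult_left_le_one_le \<open>?l * _ \<le> 1\<close>) auto
        finally show "?l * pmf (list_pmf (map W vs)) as \<le> pmf (?Q (map Y vs)) as" .
      qed
      also have "\<dots> = measure_pmf.prob (?Q (map Y vs)) (?T vs)"
        by (simp add: measure_measure_pmf_finite fin)
      finally show ?thesis
        by (intro mult_left_mono one_minus_power_le) auto
    qed
  qed
  also have "\<dots> = E (replicate_pmf n p) (\<lambda>vs. 1 - ?w vs + exp (- (real M * ?l)))"
    by (subst integral_measure_pmf[of ?A])
       (auto simp: finite_lists_length length_of_set_replicate_pmf)
  also have "\<dots> = 1 - E (replicate_pmf n p) ?w + exp (- (real M * ?l))"
    by (simp add: integrable_measure_pmf_finite finite_set_replicate_pmf)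
  \<comment> \<open>Averaged over the source word, the channel probability of its typical outputs is
    the probability of typicality under i.i.d. pairs of law \<open>J\<close>.\<close>
  also have "E (replicate_pmf n p) ?w = measure_pmf.prob (replicate_pmf n J) (jointly_typical n \<epsilon> J F)"
  proof -
    have "measure_pmf.prob (replicate_pmf n J) (jointly_typical n \<epsilon> J F)
       = E (replicate_pmf n J) (\<lambda>ws. indicator (jointly_typical n \<epsilon> J F) ws)" by simp
    also have "\<dots> = E (replicate_pmf n p) (\<lambda>vs. E (list_pmf (map W vs)) (\<lambda>as. indicat_real (jointly_typical n \<epsilon> J F) (zip vs as)))"
      unfolding J_def replicate_pmf_test_joint
      by (subst expectation_bind_pmf_finite) (auto simp: finite_set_replicate_pmf finite_set_list_pmf simp del: Bochner_Integration.integral_indicator)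
    also have "\<dots> = E (replicate_pmf n p) ?w"
    proof (rule expectation_cong_set_pmf)
      fix vs assume vs: "vs \<in> set_pmf (replicate_pmf n p)"
      have l: "length as = n" if "as \<in> set_pmf (list_pmf (map W vs))" for as
        using length_of_set_list_pmf[OF that] length_of_set_replicate_pmf[OF vs] by simp
      have "E (list_pmf (map W vs)) (\<lambda>as. indicat_real (jointly_typical n \<epsilon> J F) (zip vs as))
         = E (list_pmf (map W vs)) (indicat_real (?T vs))"
        by (rule expectation_cong_set_pmf)
           (auto simp: indicator_def l)
      then show "E (list_pmf (map W vs)) (\<lambda>as. indicat_real (jointly_typical n \<epsilon> J F) (zip vs as)) = ?w vs"
        by simp
    qed
    finally show ?thesis ..
  qed
  also have "1 - \<dots> = measure_pmf.prob (replicate_pmf n J) (- jointly_typical n \<epsilon> J F)"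
    using measure_pmf.prob_compl[of "jointly_typical n \<epsilon> J F" "replicate_pmf n J"]
    by (simp add: Compl_eq_Diff_UNIV)
  also have "\<dots> \<le> (\<Sum>f\<in>F. E J (\<lambda>w. (f w - E J f)\<^sup>2)) / (n * \<epsilon>\<^sup>2)"
    by (rule prob_not_jointly_typical) fact+
  finally have bound: "measure_pmf.prob (replicate_pmf n p)
       {vs. \<forall>as\<in>set (c (map Y vs)). zip vs as \<notin> jointly_typical n \<epsilon> J F}
     \<le> (\<Sum>f\<in>F. E J (\<lambda>w. (f w - E J f)\<^sup>2)) / (n * \<epsilon>\<^sup>2) + exp (- (real M * ?l))" by simp
  show ?thesis
    by (intro exI[of _ c] conjI bound) (simp add: c(1) len)
qed

lemma abs_sum_list_le:
  fixes f :: "'a \<Rightarrow> real" and K :: real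
  assumes "\<And>x. \<bar>f x\<bar> \<le> K"
  shows "\<bar>\<Sum>x\<leftarrow>xs. f x\<bar> \<le> length xs * K"
proof (induction xs)
  case (Cons x xs)
  have "\<bar>f x + (\<Sum>x\<leftarrow>xs. f x)\<bar> \<le> K + length xs * K"
    using assms[of x] Cons by linarith
  then show ?case by (simp add: algebra_simps)
qed simp

text \<open>The codebook rate exceeds \<open>E J i\<close>, so failures become rare, and on a finite
  type they affect the averages by a bounded amount only. The expectations thus converge to
  \<open>E J f\<close> itself, which matters because \<open>achievable\<close> asks for limits and
  not for eventual bounds.\<close>

lemma covering:
  fixes p :: "'v :: finite pmf" and W :: "'v \<Rightarrow> 'a :: finite pmf" and q :: "'y :: finite \<Rightarrow> 'a pmf"
    and Y :: "'v \<Rightarrow> 'y" and i :: "'v \<times> 'a \<Rightarrow> real"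
  defines "J \<equiv> test_joint p W"
  assumes dom: "\<And>v a. v \<in> set_pmf p \<Longrightarrow> pmf (W v) a \<le> 2 powr i (v, a) * pmf (q (Y v)) a"
    and F: "finite F" and R: "0 \<le> R" "E J i < R"
  shows "\<exists>(c :: nat \<Rightarrow> 'y list \<Rightarrow> 'a list list) (\<phi> :: nat \<Rightarrow> 'v list \<Rightarrow> 'a list).
     (\<forall>n>0. \<forall>ys. length ys = n \<longrightarrow> length (c n ys) = nat \<lfloor>2 powr (real n * R)\<rfloor> \<and> (\<forall>as\<in>set (c n ys). length as = n)) \<and>
     (\<forall>n>0. \<forall>vs. length vs = n \<longrightarrow> \<phi> n vs \<in> set (c n (map Y vs))) \<and>
     (\<forall>f\<in>F. (\<lambda>n. E (replicate_pmf n p) (\<lambda>vs. (\<Sum>w\<leftarrow>zip vs (\<phi> n vs). f w) / n)) \<longlonglongrightarrow> E J f)"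
proof -
  define F' where "F' = insert i F"
  \<comment> \<open>The exponent has to lie strictly between -1/2 and 0: both
    \<open>\<epsilon> n\<close> and the Chebyshev bound
    \<open>C / (n * (\<epsilon> n)\<^sup>2)\<close>, here \<open>C * n powr (- 1 / 2)\<close>, must
    tend to 0.\<close>
  define \<epsilon> where "\<epsilon> n = real n powr (- 1 / 4)" for n :: nat
  define M where "M n = nat \<lfloor>2 powr (real n * R)\<rfloor>" for n :: nat
  define l where "l n = 2 powr (- (real n * (E J i + \<epsilon> n)))" for n
  define C where "C = (\<Sum>f\<in>F'. E J (\<lambda>w. (f w - E J f)\<^sup>2))"
  define b where "b n = C / (n * (\<epsilon> n)\<^sup>2) + exp (- (real (M n) * l n))" for n :: nat
  let ?fail = "\<lambda>n c. {vs. \<forall>as\<in>set (c (map Y vs)). zip vs as \<notin> jointly_typical n (\<epsilon> n) J F'}"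
  define G where "G n c \<longleftrightarrow> (n > 0 \<longrightarrow>
      (\<forall>ys. length ys = n \<longrightarrow> length (c ys) = M n \<and> (\<forall>as\<in>set (c ys). length as = n)) \<and>
      measure_pmf.prob (replicate_pmf n p) (?fail n c) \<le> b n)" for n :: nat and c :: "'y list \<Rightarrow> 'a list list"
  have "\<exists>c. G n c" for n
  proof (cases "n > 0")
    case True
    then show ?thesis
      using covering_codebook[of p W i q Y F' n "\<epsilon> n" "M n"] dom F
      by (simp add: G_def F'_def \<epsilon>_def b_def C_def l_def J_def)
  qed (simp add: G_def)
  then obtain c where "\<And>n. G n (c n)" by metis
  then have c: "\<And>n ys. n > 0 \<Longrightarrow> length ys = n \<Longrightarrow> length (c n ys) = M n"
       "\<And>n ys as. n > 0 \<Longrightarrow> length ys = n \<Longrightarrow> as \<in> set (c n ys) \<Longrightarrow> length as = n"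
       "\<And>n. n > 0 \<Longrightarrow> measure_pmf.prob (replicate_pmf n p) (?fail n (c n)) \<le> b n"
    by (auto simp: G_def)
  \<comment> \<open>A nonnegative rate keeps every codebook nonempty, so that the fallback
    \<open>hd\<close> in \<open>\<phi>\<close> is a codeword.\<close>
  have M1: "M n \<ge> 1" for n
  proof -
    have "1 \<le> 2 powr (real n * R)" using R by (simp add: ge_one_powr_ge_zero)
    then show ?thesis unfolding M_def by linarith
  qed
  define good where "good n vs as \<longleftrightarrow> zip vs as \<in> jointly_typical n (\<epsilon> n) J F'" for n vs as
  define \<phi> where "\<phi> n vs = (if \<exists>as\<in>set (c n (map Y vs)). good n vs as
     then SOME as. as \<in> set (c n (map Y vs)) \<and> good n vs as else hd (c n (map Y vs)))" for n vs
  have \<phi>_good: "\<phi> n vs \<in> set (c n (map Y vs)) \<and> good n vs (\<phi> n vs)"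
    if "\<exists>as\<in>set (c n (map Y vs)). good n vs as" for n vs
    using that someI_ex[of "\<lambda>as. as \<in> set (c n (map Y vs)) \<and> good n vs as"] by (auto simp: \<phi>_def)
  have \<phi>_in: "\<phi> n vs \<in> set (c n (map Y vs))" if "n > 0" "length vs = n" for n vs
  proof (cases "\<exists>as\<in>set (c n (map Y vs)). good n vs as")
    case False
    moreover have "c n (map Y vs) \<noteq> []" using c(1)[of n "map Y vs"] M1[of n] that by auto
    ultimately show ?thesis by (simp add: \<phi>_def)
  qed (use \<phi>_good in blast)

  have \<epsilon>0: "\<epsilon> \<longlonglongrightarrow> 0"
    unfolding \<epsilon>_def by (rule tendsto_neg_powr) (auto intro: filterlim_real_sequentially)
  have l1: "(\<lambda>n. C / (n * (\<epsilon> n)\<^sup>2)) \<longlonglongrightarrow> 0"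
  proof -
    have "(\<lambda>n. C * real n powr (- 1 / 2)) \<longlonglongrightarrow> C * 0"
      by (intro tendsto_intros tendsto_neg_powr filterlim_real_sequentially) auto
    moreover have "\<forall>\<^sub>F n in sequentially. C * real n powr (- 1 / 2) = C / (n * (\<epsilon> n)\<^sup>2)"
      using eventually_gt_at_top[of 0]
    proof eventually_elim
      case (elim n)
      have "real n * (\<epsilon> n)\<^sup>2 = real n powr 1 * (real n powr (- 1 / 4) * real n powr (- 1 / 4))"
        using elim by (simp add: \<epsilon>_def power2_eq_square)
      also have "\<dots> = real n powr (1 / 2)" unfolding powr_add[symmetric] by simp
      finally show ?case by (simp add: powr_minus_divide)
    qed
    ultimately show ?thesis by (simp add: tendsto_cong)
  qed
  have l2: "(\<lambda>n. exp (- (real (M n) * l n))) \<longlonglongrightarrow> 0"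
  proof -
    define \<delta> where "\<delta> = R - E J i"
    have \<delta>: "\<delta> > 0" using R by (simp add: \<delta>_def)
    have "filterlim (\<lambda>n. real n * (\<delta> / 4 * ln 2)) at_top sequentially"
      using \<delta> by (intro filterlim_at_top_mult_tendsto_pos[OF tendsto_const] filterlim_real_sequentially) auto
    moreover have "\<forall>\<^sub>F n in sequentially. real n * (\<delta> / 4 * ln 2) \<le> real (M n) * l n"
    proof -
      have "\<forall>\<^sub>F n in sequentially. \<epsilon> n < \<delta> / 2" using \<delta> by (intro order_tendstoD(2)[OF \<epsilon>0]) simp
      then show ?thesis
      proof eventually_elim
        case (elim n)
        \<comment> \<open>The floor costs at most a factor 2, as \<open>M n\<close> is at least 1
          and at least \<open>2 powr (real n * R) - 1\<close>.\<close>
        have M: "2 powr (real n * R) / 2 \<le> real (M n)"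
        proof -
          have "2 powr (real n * R) - 1 \<le> real (M n)" unfolding M_def by linarith
          then show ?thesis using M1[of n] by linarith
        qed
        \<comment> \<open>Only divergence of \<open>M n * l n\<close> is at stake, so the
          exponential growth is weakened to a linear lower bound.\<close>
        have "real n * (\<delta> / 2) * ln 2 \<le> exp (real n * (\<delta> / 2) * ln 2)"
          using exp_ge_add_one_self[of "real n * (\<delta> / 2) * ln 2"] by linarith
        also have "\<dots> = 2 powr (real n * (\<delta> / 2))" by (simp add: powr_def mult_ac)
        also have "\<dots> \<le> 2 powr (real n * (\<delta> - \<epsilon> n))"
          using elim by (intro powr_mono mult_left_mono) auto
        also have "\<dots> = 2 powr (real n * R) * l n"
          by (simp add: l_def \<delta>_def algebra_simps flip: powr_add)
        finally have "real n * (\<delta> / 2) * ln 2 / 2 \<le> 2 powr (real n * R) / 2 * l n" by (simp add: mult_ac)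
        also have "\<dots> \<le> real (M n) * l n" using M by (intro mult_right_mono) (auto simp: l_def)
        finally show ?case by simp
      qed
    qed
    ultimately have "filterlim (\<lambda>n. real (M n) * l n) at_top sequentially"
      by (rule filterlim_at_top_mono)
    then show ?thesis
      by (intro filterlim_compose[OF exp_at_bot]) (simp add: filterlim_uminus_at_bot)
  qed
  have b0: "b \<longlonglongrightarrow> 0" unfolding b_def using tendsto_add[OF l1 l2] by simp

  have "(\<lambda>n. E (replicate_pmf n p) (\<lambda>vs. (\<Sum>w\<leftarrow>zip vs (\<phi> n vs). f w) / n)) \<longlonglongrightarrow> E J f" if f: "f \<in> F" for f
  proof -
    define K where "K = (\<Sum>w\<in>UNIV. \<bar>f w\<bar>)"
    have K: "\<bar>f w\<bar> \<le> K" for w unfolding K_def by (rule member_le_sum) auto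
    have EK: "\<bar>E J f\<bar> \<le> K"
      using measure_pmf.integral_le_const[of J f K] measure_pmf.integral_ge_const[of J f "- K"] K
      by (auto simp: abs_le_iff integrable_measure_pmf_finite minus_le_iff)
    have K0: "0 \<le> K" using K abs_ge_zero order_trans by blast
    let ?d = "\<lambda>n vs. (\<Sum>w\<leftarrow>zip vs (\<phi> n vs). f w) / n"
    have "\<forall>\<^sub>F n in sequentially. norm (E (replicate_pmf n p) (?d n) - E J f) \<le> \<epsilon> n + 2 * K * b n"
      using eventually_gt_at_top[of 0]
    proof eventually_elim
      case (elim n)
      let ?P = "replicate_pmf n p"
      note [simp] = integrable_measure_pmf_finite[OF finite_set_replicate_pmf]
      \<comment> \<open>On success the average is within \<open>\<epsilon> n\<close> of
        \<open>E J f\<close>; on failure both are bounded by \<open>K\<close> in absolute value,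
        whence 2 * K.\<close>
      have pt: "\<bar>?d n vs - E J f\<bar> \<le> \<epsilon> n + 2 * K * indicat_real (?fail n (c n)) vs"
        if vs: "vs \<in> set_pmf ?P" for vs
      proof -
        have len: "length vs = n" "length (\<phi> n vs) = n"
          using length_of_set_replicate_pmf[OF vs] c(2)[OF elim _ \<phi>_in] elim by auto
        show ?thesis
        proof (cases "\<exists>as\<in>set (c n (map Y vs)). good n vs as")
          case True
          then have "\<bar>(\<Sum>w\<leftarrow>zip vs (\<phi> n vs). f w) - n * E J f\<bar> \<le> n * \<epsilon> n"
            using \<phi>_good[OF True] f by (auto simp: good_def jointly_typical_def F'_def)
          also have "(\<Sum>w\<leftarrow>zip vs (\<phi> n vs). f w) - n * E J f = n * (?d n vs - E J f)"
            using elim by (simp add: field_simps)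
          finally have "\<bar>?d n vs - E J f\<bar> \<le> \<epsilon> n" using elim by (simp add: abs_mult)
          moreover have "0 \<le> 2 * K * indicat_real (?fail n (c n)) vs" using K0 by simp
          ultimately show ?thesis by linarith
        next
          case False
          then have fail: "vs \<in> ?fail n (c n)" by (auto simp: good_def)
          have "\<bar>?d n vs\<bar> \<le> K"
            using abs_sum_list_le[of f K "zip vs (\<phi> n vs)"] K len elim by (simp add: field_simps)
          moreover have "0 \<le> \<epsilon> n" by (simp add: \<epsilon>_def)
          moreover have "\<bar>?d n vs - E J f\<bar> \<le> \<bar>?d n vs\<bar> + \<bar>E J f\<bar>" by (rule abs_triangle_ineq4)
          ultimately have "\<bar>?d n vs - E J f\<bar> \<le> \<epsilon> n + 2 * K * 1" using EK by linarith
          then show ?thesis using fail by (simp only: indicator_simps)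
        qed
      qed
      have "\<bar>E ?P (?d n) - E J f\<bar> = \<bar>E ?P (\<lambda>vs. ?d n vs - E J f)\<bar>" by simp
      also have "\<dots> \<le> E ?P (\<lambda>vs. \<bar>?d n vs - E J f\<bar>)" by (rule integral_abs_bound)
      also have "\<dots> \<le> E ?P (\<lambda>vs. \<epsilon> n + 2 * K * indicat_real (?fail n (c n)) vs)"
        by (intro expectation_mono_finite finite_set_replicate_pmf pt)
      also have "\<dots> = \<epsilon> n + 2 * K * measure_pmf.prob ?P (?fail n (c n))" by simp
      also have "\<dots> \<le> \<epsilon> n + 2 * K * b n"
        using c(3)[OF elim] K0 by (intro add_left_mono mult_left_mono) auto
      finally show ?case by simp
    qed
    moreover have "(\<lambda>n. \<epsilon> n + 2 * K * b n) \<longlonglongrightarrow> 0 + 2 * K * 0"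
      by (intro tendsto_intros \<epsilon>0 b0)
    ultimately have "(\<lambda>n. E (replicate_pmf n p) (?d n) - E J f) \<longlonglongrightarrow> 0"
      by (rule_tac Lim_null_comparison[where g = "\<lambda>n. \<epsilon> n + 2 * K * b n"]) simp_all
    then show ?thesis by (simp add: LIM_zero_iff)
  qed
  then show ?thesis
    using c(1,2) \<phi>_in unfolding M_def by (intro exI[of _ c] exI[of _ \<phi>]) auto
qed

section \<open>Conditional mutual information on finite types\<close>

text \<open>Disintegration. With \<open>map_fst_test_joint\<close> it identifies the laws
  \<open>test_joint p W\<close> with the laws of first marginal \<open>p\<close>, so minimising over
  kernels becomes minimising over pmfs under linear conditions.\<close>

lemma ex_test_joint: "\<exists>W. J = test_joint (map_pmf fst J) W"
proof -
  define W where "W u = map_pmf snd (cond_pmf J {w. u = fst w})" for u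
  have "J = bind_pmf (map_pmf fst J) (\<lambda>u. cond_pmf J {w. u = fst w})"
    by (rule bind_cond_pmf_cancel[symmetric])
       (auto simp: vimage_def intro!: arg_cong[where f = "measure J"])
  also have "\<dots> = bind_pmf (map_pmf fst J) (\<lambda>u. map_pmf (Pair u) (W u))"
  proof (rule bind_pmf_cong[OF refl])
    fix u assume "u \<in> set_pmf (map_pmf fst J)"
    then have "set_pmf J \<inter> {w. u = fst w} \<noteq> {}" by auto
    note [simp] = set_cond_pmf[OF this]
    have "map_pmf (\<lambda>w. (u, snd w)) (cond_pmf J {w. u = fst w}) = map_pmf id (cond_pmf J {w. u = fst w})"
      by (rule map_pmf_cong) auto
    then show "cond_pmf J {w. u = fst w} = map_pmf (Pair u) (W u)"
      by (simp add: W_def pmf.map_comp o_def)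
  qed
  finally show ?thesis unfolding test_joint_def by blast
qed

lemma map_fst_test_joint: "map_pmf fst (test_joint p W) = p"
  by (simp add: test_joint_def map_bind_pmf pmf.map_comp o_def bind_return_pmf')

lemma pmf_map_sum:
  fixes J :: "'w :: finite pmf"
  shows "pmf (map_pmf f J) z = (\<Sum>w | f w = z. pmf J w)"
  by (simp add: pmf_map measure_measure_pmf_finite vimage_def)

lemma pmf_map_pos: "w \<in> set_pmf J \<Longrightarrow> 0 < pmf (map_pmf f J) (f w)"
  by (rule pmf_positive) auto

text \<open>The likelihood ratio p(a,b|c) / (p(a|c) p(b|c)) with the conditional probabilities
  multiplied out; its logarithm is the conditional information density.\<close>

definition info_ratio :: "'w pmf \<Rightarrow> ('w \<Rightarrow> 'a) \<Rightarrow> ('w \<Rightarrow> 'b) \<Rightarrow> ('w \<Rightarrow> 'c) \<Rightarrow> 'w \<Rightarrow> real" where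
  "info_ratio J A B C w =
     pmf (map_pmf (\<lambda>w. (A w, B w, C w)) J) (A w, B w, C w) * pmf (map_pmf C J) (C w) /
     (pmf (map_pmf (\<lambda>w. (A w, C w)) J) (A w, C w) * pmf (map_pmf (\<lambda>w. (B w, C w)) J) (B w, C w))"

lemma info_ratio_pos: "w \<in> set_pmf J \<Longrightarrow> 0 < info_ratio J A B C w"
  unfolding info_ratio_def by (intro divide_pos_pos mult_pos_pos pmf_map_pos[of w J])

lemma simple_distributed_pmf:
  fixes J :: "'w :: finite pmf"
  shows "simple_distributed (measure_pmf J) X (pmf (map_pmf X J))"
  by (rule measure_pmf.simple_distributedI) (auto simp: pmf_map simple_function_def)

lemma information_space_pmf: "information_space (measure_pmf J) 2"
  by unfold_locales simp

lemma cond_mutual_info_eq_expectation: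
  fixes J :: "'w :: finite pmf"
  shows "cond_mutual_info J A B C = E J (\<lambda>w. log 2 (info_ratio J A B C w))"
proof -
  let ?T = "\<lambda>w. (A w, B w, C w)"
  let ?g = "\<lambda>(x, y, z). log 2 (pmf (map_pmf ?T J) (x, y, z) / (pmf (map_pmf (\<lambda>w. (A w, C w)) J) (x, z) *
      (pmf (map_pmf (\<lambda>w. (B w, C w)) J) (y, z) / pmf (map_pmf C J) z)))"
  have "cond_mutual_info J A B C = (\<Sum>(x, y, z)\<in>range ?T. pmf (map_pmf ?T J) (x, y, z) *
      log 2 (pmf (map_pmf ?T J) (x, y, z) / (pmf (map_pmf (\<lambda>w. (A w, C w)) J) (x, z) *
      (pmf (map_pmf (\<lambda>w. (B w, C w)) J) (y, z) / pmf (map_pmf C J) z))))"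
    using information_space.conditional_mutual_information_eq[OF information_space_pmf
      simple_distributed_pmf simple_distributed_pmf simple_distributed_pmf simple_distributed_pmf,
      unfolded space_measure_pmf]
    unfolding cond_mutual_info_def .
  also have "\<dots> = (\<Sum>t\<in>range ?T. pmf (map_pmf ?T J) t * ?g t)"
    by (intro sum.cong) (simp_all only: case_prod_beta' prod.collapse)
  also have "\<dots> = E (map_pmf ?T J) ?g"
    by (subst integral_measure_pmf[of "range ?T"]) auto
  also have "\<dots> = E J (\<lambda>w. log 2 (info_ratio J A B C w))"
    by (simp add: info_ratio_def)
  finally show ?thesis .
qed

lemma cond_mutual_info_nonneg:
  fixes J :: "'w :: finite pmf"
  shows "0 \<le> cond_mutual_info J A B C"
  unfolding cond_mutual_info_def
  using information_space.conditional_mutual_information_nonneg[OF information_space_pmf, of J A B C]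
  by (simp add: simple_function_def)

section \<open>Continuity of conditional mutual information and compactness of the set of
  pmfs\<close>

lemma abs_mult_ln_le:
  fixes x :: real
  assumes "0 \<le> x" "x \<le> 1"
  shows "\<bar>x * ln x\<bar> \<le> 2 * sqrt x"
proof (cases "x = 0")
  case False
  \<comment> \<open>With x = t * t, the bound -ln t \<le> 1 / t gives -(x ln x) \<le> 2 t, which
    controls x ln x near 0.\<close>
  define t where "t = sqrt x"
  have t: "t > 0" "x = t * t" using assms False by (auto simp: t_def)
  have "- ln t = ln (1 / t)" using t by (simp add: ln_div)
  also have "\<dots> \<le> 1 / t - 1" using t by (intro ln_le_minus_one) auto
  finally have "- ln t \<le> 1 / t" by simp
  then have "x * (- ln t) \<le> x * (1 / t)" using assms by (intro mult_left_mono)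
  then have "x * (- ln x) \<le> 2 * t" using t by (simp add: ln_mult)
  moreover have "x * ln x \<le> 0" using assms False by (intro mult_nonneg_nonpos) auto
  ultimately show ?thesis by (simp add: t_def)
qed simp

text \<open>At 0 this rests on the square-root bound and the convention 0 * log 2 0 = 0; elsewhere
  the logarithm is continuous.\<close>

lemma tendsto_mult_log:
  fixes x :: "nat \<Rightarrow> real"
  assumes lim: "x \<longlonglongrightarrow> a" and x: "\<And>k. 0 \<le> x k" "\<And>k. x k \<le> 1"
  shows "(\<lambda>k. x k * log 2 (x k)) \<longlonglongrightarrow> a * log 2 a"
proof (cases "a = 0")
  case True
  have "(\<lambda>k. 2 * sqrt (x k)) \<longlonglongrightarrow> 2 * sqrt 0"
    using lim True by (intro tendsto_intros) simp
  moreover have "\<forall>\<^sub>F k in sequentially. norm (x k * ln (x k)) \<le> 2 * sqrt (x k)"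
    using abs_mult_ln_le[OF x] by (intro always_eventually allI) (simp only: real_norm_def)
  ultimately have "(\<lambda>k. x k * ln (x k)) \<longlonglongrightarrow> 0"
    by (rule_tac Lim_null_comparison[where g = "\<lambda>k. 2 * sqrt (x k)"]) simp_all
  then have "(\<lambda>k. x k * ln (x k) / ln 2) \<longlonglongrightarrow> 0 / ln 2"
    by (rule tendsto_divide[OF _ tendsto_const]) simp
  then show ?thesis using True by (simp add: log_def)
next
  case False
  moreover have "a \<ge> 0" using LIMSEQ_le_const[OF lim] x(1) by blast
  ultimately have "a > 0" by simp
  then show ?thesis by (intro tendsto_mult tendsto_log tendsto_const lim) simp_all
qed

lemma expectation_log_pmf_map:
  fixes J :: "'w :: finite pmf"
  shows "E J (\<lambda>w. log 2 (pmf (map_pmf f J) (f w))) =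
    (\<Sum>t\<in>range f. pmf (map_pmf f J) t * log 2 (pmf (map_pmf f J) t))"
proof -
  have "E (map_pmf f J) (\<lambda>t. log 2 (pmf (map_pmf f J) t)) = (\<Sum>t\<in>range f. pmf (map_pmf f J) t * log 2 (pmf (map_pmf f J) t))"
    by (subst integral_measure_pmf[of "range f"]) auto
  then show ?thesis by simp
qed

text \<open>The ratio may jump where a marginal vanishes in the limit. Each of the four terms,
  however, is a finite sum of x log x over the values of one marginal and hence continuous in the
  pmf. The logarithm is split on the support only, where all four factors are positive.\<close>

lemma cond_mutual_info_entropies:
  fixes J :: "'w :: finite pmf"
  shows "cond_mutual_info J A B C =
    E J (\<lambda>w. log 2 (pmf (map_pmf (\<lambda>w. (A w, B w, C w)) J) (A w, B w, C w)))
     + E J (\<lambda>w. log 2 (pmf (map_pmf C J) (C w)))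
     - E J (\<lambda>w. log 2 (pmf (map_pmf (\<lambda>w. (A w, C w)) J) (A w, C w)))
     - E J (\<lambda>w. log 2 (pmf (map_pmf (\<lambda>w. (B w, C w)) J) (B w, C w)))"
proof -
  note [simp] = integrable_measure_pmf_finite
  have "cond_mutual_info J A B C = E J (\<lambda>w. log 2 (pmf (map_pmf (\<lambda>w. (A w, B w, C w)) J) (A w, B w, C w))
     + log 2 (pmf (map_pmf C J) (C w))
     - log 2 (pmf (map_pmf (\<lambda>w. (A w, C w)) J) (A w, C w))
     - log 2 (pmf (map_pmf (\<lambda>w. (B w, C w)) J) (B w, C w)))"
    unfolding cond_mutual_info_eq_expectation
  proof (rule expectation_cong_set_pmf)
    fix w assume w: "w \<in> set_pmf J"
    note pos = pmf_map_pos[OF w, of "\<lambda>w. (A w, B w, C w)"] pmf_map_pos[OF w, of C]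
      pmf_map_pos[OF w, of "\<lambda>w. (A w, C w)"] pmf_map_pos[OF w, of "\<lambda>w. (B w, C w)"]
    show "log 2 (info_ratio J A B C w) = log 2 (pmf (map_pmf (\<lambda>w. (A w, B w, C w)) J) (A w, B w, C w))
     + log 2 (pmf (map_pmf C J) (C w))
     - log 2 (pmf (map_pmf (\<lambda>w. (A w, C w)) J) (A w, C w))
     - log 2 (pmf (map_pmf (\<lambda>w. (B w, C w)) J) (B w, C w))"
      unfolding info_ratio_def
      using pos by (simp add: log_mult_pos log_divide_pos)
  qed
  also have "\<dots> = E J (\<lambda>w. log 2 (pmf (map_pmf (\<lambda>w. (A w, B w, C w)) J) (A w, B w, C w)))
     + E J (\<lambda>w. log 2 (pmf (map_pmf C J) (C w)))
     - E J (\<lambda>w. log 2 (pmf (map_pmf (\<lambda>w. (A w, C w)) J) (A w, C w)))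
     - E J (\<lambda>w. log 2 (pmf (map_pmf (\<lambda>w. (B w, C w)) J) (B w, C w)))"
    by simp
  finally show ?thesis .
qed

lemma tendsto_pmf_map:
  fixes J :: "'w :: finite pmf"
  assumes "\<And>w. (\<lambda>k. pmf (Js k) w) \<longlonglongrightarrow> pmf J w"
  shows "(\<lambda>k. pmf (map_pmf f (Js k)) z) \<longlonglongrightarrow> pmf (map_pmf f J) z"
  unfolding pmf_map_sum by (intro tendsto_intros assms)

lemma tendsto_cond_mutual_info:
  fixes J :: "'w :: finite pmf"
  assumes "\<And>w. (\<lambda>k. pmf (Js k) w) \<longlonglongrightarrow> pmf J w"
  shows "(\<lambda>k. cond_mutual_info (Js k) A B C) \<longlonglongrightarrow> cond_mutual_info J A B C"
  unfolding cond_mutual_info_entropies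
    expectation_log_pmf_map[where f = "\<lambda>w. (A w, B w, C w)"] expectation_log_pmf_map[where f = C]
    expectation_log_pmf_map[where f = "\<lambda>w. (A w, C w)"] expectation_log_pmf_map[where f = "\<lambda>w. (B w, C w)"]
  by (intro tendsto_add tendsto_diff tendsto_sum tendsto_mult_log tendsto_pmf_map assms pmf_nonneg pmf_le_1)

lemma tendsto_expectation_finite:
  fixes J :: "'w :: finite pmf" and f :: "'w \<Rightarrow> real"
  assumes "\<And>w. (\<lambda>k. pmf (Js k) w) \<longlonglongrightarrow> pmf J w"
  shows "(\<lambda>k. E (Js k) f) \<longlonglongrightarrow> E J f"
  unfolding expectation_finite_sum by (intro tendsto_intros assms)

text \<open>Pmfs on a finite type are vectors of l1 norm 1. Bolzano-Weierstrass yields a convergent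
  subsequence, and nonnegativity and total mass 1 pass to the limit because the sum is
  finite.\<close>

lemma pmf_seq_compact:
  fixes Js :: "nat \<Rightarrow> 'w :: finite pmf"
  shows "\<exists>J r. strict_mono r \<and> (\<forall>w. (\<lambda>k. pmf (Js (r k)) w) \<longlonglongrightarrow> pmf J w)"
proof -
  define v where "v k = (\<chi> w. pmf (Js k) w)" for k
  have "norm (v k) \<le> (\<Sum>w\<in>UNIV. \<bar>v k $ w\<bar>)" for k by (rule norm_le_l1_cart)
  moreover have "(\<Sum>w\<in>UNIV. \<bar>v k $ w\<bar>) = 1" for k
    by (simp add: v_def sum_pmf_eq_1)
  ultimately have "bounded (range v)" by (auto simp: bounded_iff)
  then obtain l r where r: "strict_mono r" "(v \<circ> r) \<longlonglongrightarrow> l"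
    using bounded_imp_convergent_subsequence by blast
  have lim: "(\<lambda>k. pmf (Js (r k)) w) \<longlonglongrightarrow> l $ w" for w
    using tendsto_vec_nth[OF r(2), of w] by (simp add: v_def o_def)
  have nn: "l $ w \<ge> 0" for w by (rule LIMSEQ_le_const[OF lim]) auto
  have "(\<lambda>k. \<Sum>w\<in>UNIV. pmf (Js (r k)) w) \<longlonglongrightarrow> (\<Sum>w\<in>UNIV. l $ w)"
    by (intro tendsto_intros lim)
  then have "(\<Sum>w\<in>UNIV. l $ w) = 1"
    by (simp add: sum_pmf_eq_1 LIMSEQ_const_iff)
  then have "(\<integral>\<^sup>+ w. ennreal (l $ w) \<partial>count_space UNIV) = 1"
    by (simp add: nn_integral_count_space_finite nn)
  then have "pmf (embed_pmf (($) l)) w = l $ w" for w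
    by (intro pmf_embed_pmf nn)
  with lim r(1) show ?thesis by (intro exI[of _ "embed_pmf (($) l)"] exI[of _ r]) simp
qed

section \<open>The converse for one block length\<close>

lemma pmf_replicate_pmf: "length xs = n \<Longrightarrow> pmf (replicate_pmf n p) xs = prod_list (map (pmf p) xs)"
  by (induction xs arbitrary: n) (auto simp: pmf_replicate_pmf_Cons simp del: replicate_pmf.simps(2))

text \<open>The fibre is a product set, so the sum of products is a product of letter sums.
  Nonnegativity is part of the induction because inequalities are multiplied.\<close>

lemma sum_prod_list_fibre_le:
  fixes h :: "'v :: finite \<Rightarrow> 'a \<Rightarrow> real"
  assumes "length as = length ys"
    and nn: "\<And>v a. 0 \<le> h v a" and le: "\<And>y a. (\<Sum>v | Y v = y. h v a) \<le> q y"
  shows "finite {vs. map Y vs = ys} \<and> 0 \<le> (\<Sum>vs | map Y vs = ys. prod_list (map2 h vs as)) \<and>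
    (\<Sum>vs | map Y vs = ys. prod_list (map2 h vs as)) \<le> prod_list (map q ys)"
  using assms(1)
proof (induction as ys rule: list_induct2)
  case (Cons a as y ys)
  have eq: "{vs. map Y vs = y # ys} = (\<lambda>(v, vs). v # vs) ` ({v. Y v = y} \<times> {vs. map Y vs = ys})"
    by auto
  have inj: "inj_on (\<lambda>(v, vs). v # vs) ({v. Y v = y} \<times> {vs. map Y vs = ys})"
    by (auto simp: inj_on_def)
  have s: "(\<Sum>vs | map Y vs = y # ys. prod_list (map2 h vs (a # as)))
     = (\<Sum>v | Y v = y. h v a) * (\<Sum>vs | map Y vs = ys. prod_list (map2 h vs as))"
    unfolding eq sum.reindex[OF inj]
    by (simp add: case_prod_unfold sum_product sum.cartesian_product o_def)
  have nn': "0 \<le> (\<Sum>v | Y v = y. h v a)" by (intro sum_nonneg nn)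
  show ?case
  proof (intro conjI)
    show "finite {vs. map Y vs = y # ys}" unfolding eq using Cons.IH by simp
    show "0 \<le> (\<Sum>vs | map Y vs = y # ys. prod_list (map2 h vs (a # as)))"
      unfolding s using Cons.IH nn' by simp
    have "0 \<le> q y" using nn' le[of a y] by linarith
    then show "(\<Sum>vs | map Y vs = y # ys. prod_list (map2 h vs (a # as))) \<le> prod_list (map q (y # ys))"
      unfolding s using Cons.IH le[of a y] by (simp add: mult_mono)
  qed
qed simp

lemma ln_prod_list_map:
  fixes f :: "'a \<Rightarrow> real"
  assumes "\<And>x. x \<in> set xs \<Longrightarrow> 0 < f x"
  shows "0 < prod_list (map f xs) \<and> ln (prod_list (map f xs)) = (\<Sum>x\<leftarrow>xs. ln (f x))"
  using assms by (induction xs) (auto simp: ln_mult_pos)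

lemma prod_list_map2_weight:
  fixes f :: "'v \<Rightarrow> real"
  assumes "length vs = length as"
  shows "prod_list (map2 (\<lambda>v a. f v * g v a) vs as) = prod_list (map f vs) * prod_list (map2 g vs as)"
  using assms by (induction vs as rule: list_induct2) (auto simp: mult_ac)

text \<open>The inequality \<open>ln x \<le> x - 1\<close>, applied to the product of the ratios \<open>g\<close> divided by \<open>M\<close>,
  replaces the usual chain of entropy inequalities.\<close>

lemma expectation_log_ratio_le:
  fixes p :: "'v :: finite pmf" and g :: "'v \<Rightarrow> 'a \<Rightarrow> real" and Y :: "'v \<Rightarrow> 'y :: finite"
  assumes g0: "\<And>v a. 0 \<le> g v a"
    and le: "\<And>y a. (\<Sum>v | Y v = y. pmf p v * g v a) \<le> pmf (map_pmf Y p) y"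
    and len: "\<And>vs. length vs = n \<Longrightarrow> length (\<phi> vs) = n"
    and card: "\<And>ys. length ys = n \<Longrightarrow> card (\<phi> ` {vs. map Y vs = ys}) \<le> M"
    and pos: "\<And>vs v a. vs \<in> set_pmf (replicate_pmf n p) \<Longrightarrow> (v, a) \<in> set (zip vs (\<phi> vs)) \<Longrightarrow> 0 < g v a"
    and M: "0 < M"
  shows "E (replicate_pmf n p) (\<lambda>vs. \<Sum>(v, a)\<leftarrow>zip vs (\<phi> vs). log 2 (g v a)) \<le> log 2 M"
proof -
  let ?P = "replicate_pmf n p"
  let ?A = "{vs :: 'v list. length vs = n}" and ?B = "{ys :: 'y list. length ys = n}"
  let ?h = "\<lambda>v a. pmf p v * g v a"
  let ?G = "\<lambda>vs. prod_list (map2 g vs (\<phi> vs))"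
  note [simp] = integrable_measure_pmf_finite[OF finite_set_replicate_pmf]
  \<comment> \<open>For fixed \<open>ys\<close>, \<open>\<phi>\<close> takes at most
    \<open>M\<close> values. Bounding each term by the sum over all these values decouples the
    reconstruction from the source word; each value then contributes at most the probability of
    \<open>ys\<close>.\<close>
  have fib: "(\<Sum>vs | map Y vs = ys. prod_list (map2 ?h vs (\<phi> vs))) \<le> M * pmf (replicate_pmf n (map_pmf Y p)) ys"
    if ys: "length ys = n" for ys
  proof -
    let ?F = "{vs. map Y vs = ys}"
    have fin: "finite ?F" by (rule finite_subset[OF _ finite_lists_length[of n]]) (use ys in auto)
    have h0: "0 \<le> prod_list (map2 ?h vs as)" for vs as
      by (induction vs as rule: list_induct2') (auto simp: g0)
    have "(\<Sum>vs\<in>?F. prod_list (map2 ?h vs (\<phi> vs))) \<le> (\<Sum>vs\<in>?F. \<Sum>as\<in>\<phi> ` ?F. prod_list (map2 ?h vs as))"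
      using fin h0 by (intro sum_mono member_le_sum) auto
    also have "\<dots> = (\<Sum>as\<in>\<phi> ` ?F. \<Sum>vs\<in>?F. prod_list (map2 ?h vs as))" by (rule sum.swap)
    also have "\<dots> \<le> (\<Sum>as\<in>\<phi> ` ?F. prod_list (map (pmf (map_pmf Y p)) ys))"
    proof (rule sum_mono)
      fix as assume "as \<in> \<phi> ` ?F"
      then have "length as = length ys" using len ys by auto
      from sum_prod_list_fibre_le[OF this, of ?h Y "pmf (map_pmf Y p)"] g0 le
      show "(\<Sum>vs\<in>?F. prod_list (map2 ?h vs as)) \<le> prod_list (map (pmf (map_pmf Y p)) ys)" by simp
    qed
    also have "\<dots> = card (\<phi> ` ?F) * pmf (replicate_pmf n (map_pmf Y p)) ys"
      using ys by (simp add: pmf_replicate_pmf)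
    also have "\<dots> \<le> M * pmf (replicate_pmf n (map_pmf Y p)) ys"
      using card[OF ys] by (intro mult_right_mono) auto
    finally show ?thesis .
  qed
  \<comment> \<open>The source weights are absorbed into \<open>?h\<close>; summing
    \<open>fib\<close> over all \<open>ys\<close> shows that the product of ratios has mean at most
    \<open>M\<close>.\<close>
  have "E ?P ?G = (\<Sum>vs\<in>?A. prod_list (map2 ?h vs (\<phi> vs)))"
    by (subst integral_measure_pmf[of ?A])
       (auto simp: finite_lists_length length_of_set_replicate_pmf pmf_replicate_pmf prod_list_map2_weight len
         intro!: sum.cong)
  also have "\<dots> = (\<Sum>ys\<in>?B. \<Sum>vs\<in>{vs\<in>?A. map Y vs = ys}. prod_list (map2 ?h vs (\<phi> vs)))"
    by (rule sum.group[symmetric]) (auto simp: finite_lists_length)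
  also have "\<dots> = (\<Sum>ys\<in>?B. \<Sum>vs | map Y vs = ys. prod_list (map2 ?h vs (\<phi> vs)))"
    by (intro sum.cong) auto
  also have "\<dots> \<le> (\<Sum>ys\<in>?B. M * pmf (replicate_pmf n (map_pmf Y p)) ys)"
    by (intro sum_mono fib) auto
  also have "\<dots> = M * (\<Sum>ys\<in>?B. pmf (replicate_pmf n (map_pmf Y p)) ys)"
    by (simp add: sum_distrib_left)
  also have "(\<Sum>ys\<in>?B. pmf (replicate_pmf n (map_pmf Y p)) ys) = 1"
    by (rule sum_pmf_eq_1) (auto simp: finite_lists_length length_of_set_replicate_pmf)
  finally have EG: "E ?P ?G \<le> M" by simp
  have "E ?P (\<lambda>vs. \<Sum>(v, a)\<leftarrow>zip vs (\<phi> vs). log 2 (g v a)) \<le> E ?P (\<lambda>vs. log 2 M + (?G vs / M - 1) / ln 2)"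
  proof (rule expectation_mono_finite[OF finite_set_replicate_pmf])
    fix vs assume vs: "vs \<in> set_pmf ?P"
    have G: "0 < ?G vs" "ln (?G vs) = (\<Sum>(v, a)\<leftarrow>zip vs (\<phi> vs). ln (g v a))"
      using ln_prod_list_map[of "zip vs (\<phi> vs)" "\<lambda>(v, a). g v a"] pos[OF vs]
      by (auto simp: case_prod_unfold)
    \<comment> \<open>Normalised by \<open>M\<close> the product has mean at most 1, so the
      right-hand side has nonpositive expectation.\<close>
    have "ln (?G vs / M) \<le> ?G vs / M - 1" using G M by (intro ln_le_minus_one) auto
    then have "ln (?G vs) \<le> ln M + (?G vs / M - 1)" using G M by (simp add: ln_div)
    then have "ln (?G vs) / ln 2 \<le> (ln M + (?G vs / M - 1)) / ln 2" by (intro divide_right_mono) auto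
    moreover have "(\<Sum>(v, a)\<leftarrow>zs. log 2 (g v a)) = (\<Sum>(v, a)\<leftarrow>zs. ln (g v a)) / ln 2" for zs
      by (induction zs) (auto simp: log_def add_divide_distrib)
    ultimately show "(\<Sum>(v, a)\<leftarrow>zip vs (\<phi> vs). log 2 (g v a)) \<le> log 2 M + (?G vs / M - 1) / ln 2"
      by (simp add: G(2)[symmetric] log_def add_divide_distrib)
  qed
  also have "\<dots> = log 2 M + (E ?P ?G / M - 1) / ln 2" by simp
  also have "\<dots> \<le> log 2 M"
  proof -
    have "E ?P ?G / M - 1 \<le> 0" using EG M by simp
    then show ?thesis by (simp add: divide_nonpos_pos)
  qed
  finally show ?thesis .
qed

text \<open>The law of the source letter and its reconstruction at a uniformly random position. At n
  = 0 \<open>pmf_of_set\<close> is unspecified, hence the assumption n > 0 in what follows.\<close>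

definition avg_joint :: "nat \<Rightarrow> 'v pmf \<Rightarrow> ('v list \<Rightarrow> 'a list) \<Rightarrow> ('v \<times> 'a) pmf" where
  "avg_joint n p \<phi> = bind_pmf (replicate_pmf n p) (\<lambda>vs. map_pmf ((!) (zip vs (\<phi> vs))) (pmf_of_set {..<n}))"

lemma expectation_avg_joint:
  fixes p :: "'v :: finite pmf" and f :: "'v \<times> 'a \<Rightarrow> real"
  assumes n: "n > 0" and len: "\<And>vs. length vs = n \<Longrightarrow> length (\<phi> vs) = n"
  shows "E (avg_joint n p \<phi>) f = E (replicate_pmf n p) (\<lambda>vs. (\<Sum>w\<leftarrow>zip vs (\<phi> vs). f w) / n)"
proof -
  have fin: "finite (set_pmf (pmf_of_set {..<n}))" using n by (subst set_pmf_of_set) auto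
  have "E (avg_joint n p \<phi>) f = E (replicate_pmf n p) (\<lambda>vs. E (pmf_of_set {..<n}) (\<lambda>i. f (zip vs (\<phi> vs) ! i)))"
    unfolding avg_joint_def using fin
    by (subst expectation_bind_pmf_finite) (auto simp: finite_set_replicate_pmf)
  also have "\<dots> = E (replicate_pmf n p) (\<lambda>vs. (\<Sum>w\<leftarrow>zip vs (\<phi> vs). f w) / n)"
  proof (rule expectation_cong_set_pmf)
    fix vs assume "vs \<in> set_pmf (replicate_pmf n p)"
    then have l: "length (zip vs (\<phi> vs)) = n" using len by (simp add: length_of_set_replicate_pmf)
    have "E (pmf_of_set {..<n}) (\<lambda>i. f (zip vs (\<phi> vs) ! i)) = (\<Sum>i<n. f (zip vs (\<phi> vs) ! i)) / n"
      using n by (subst integral_pmf_of_set) auto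
    also have "(\<Sum>i<n. f (zip vs (\<phi> vs) ! i)) = (\<Sum>w\<leftarrow>zip vs (\<phi> vs). f w)"
      unfolding sum_list_sum_nth length_map l by (intro sum.cong) (auto simp: l simp del: nth_zip length_zip)
    finally show "E (pmf_of_set {..<n}) (\<lambda>i. f (zip vs (\<phi> vs) ! i)) = (\<Sum>w\<leftarrow>zip vs (\<phi> vs). f w) / n" .
  qed
  finally show ?thesis .
qed

lemma map_fst_avg_joint:
  fixes p :: "'v :: finite pmf"
  assumes n: "n > 0" and len: "\<And>vs. length vs = n \<Longrightarrow> length (\<phi> vs) = n"
  shows "map_pmf fst (avg_joint n p \<phi>) = p"
proof (rule pmf_eqI)
  fix v
  have "pmf (map_pmf fst (avg_joint n p \<phi>)) v = E (map_pmf fst (avg_joint n p \<phi>)) (indicat_real {v})"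
    by (simp add: measure_pmf_single del: integral_map_pmf)
  also have "\<dots> = E (avg_joint n p \<phi>) (\<lambda>w. indicat_real {v} (fst w))" by (rule integral_map_pmf)
  also have "\<dots> = E (replicate_pmf n p) (\<lambda>vs. (\<Sum>w\<leftarrow>zip vs (\<phi> vs). indicat_real {v} (fst w)) / n)"
    by (rule expectation_avg_joint[OF n len])
  also have "\<dots> = E (replicate_pmf n p) (\<lambda>vs. (\<Sum>u\<leftarrow>vs. indicat_real {v} u) / n)"
  proof (rule expectation_cong_set_pmf)
    fix vs assume "vs \<in> set_pmf (replicate_pmf n p)"
    then have l: "length vs = length (\<phi> vs)" using len by (simp add: length_of_set_replicate_pmf)
    have "map (\<lambda>w. indicat_real {v} (fst w)) (zip vs (\<phi> vs)) = map (indicat_real {v}) (map fst (zip vs (\<phi> vs)))"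
      by simp
    also have "map fst (zip vs (\<phi> vs)) = vs" using l by simp
    finally show "(\<Sum>w\<leftarrow>zip vs (\<phi> vs). indicat_real {v} (fst w)) / n = (\<Sum>u\<leftarrow>vs. indicat_real {v} u) / n"
      by simp
  qed
  also have "\<dots> = E p (indicat_real {v})"
    using n by (simp add: expectation_replicate_sum_list)
  also have "\<dots> = pmf p v" by (simp add: measure_pmf_single)
  finally show "pmf (map_pmf fst (avg_joint n p \<phi>)) v = pmf p v" .
qed

text \<open>Ratios formed from the averaged law are positive on its support. This puts every letter
  pair of every block of positive probability into that support, so the logarithms in the converse
  are meaningful.\<close>

lemma set_avg_joint:
  assumes "n > 0" "vs \<in> set_pmf (replicate_pmf n p)" "length (\<phi> vs) = n" "w \<in> set (zip vs (\<phi> vs))"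
  shows "w \<in> set_pmf (avg_joint n p \<phi>)"
proof -
  from assms have "length (zip vs (\<phi> vs)) = n" by (simp add: length_of_set_replicate_pmf)
  with assms(4) obtain i where "i < n" "w = zip vs (\<phi> vs) ! i" by (metis in_set_conv_nth)
  with assms(1,2) show ?thesis
    unfolding avg_joint_def set_bind_pmf set_map_pmf by (subst set_pmf_of_set) auto
qed

lemma expectation_list_pmf_zip:
  fixes K :: "'v \<Rightarrow> 's :: finite pmf" and h :: "'s \<Rightarrow> 'a \<Rightarrow> real"
  assumes "length vs = length cs"
  shows "E (list_pmf (map K vs)) (\<lambda>ss. \<Sum>(s, c)\<leftarrow>zip ss cs. h s c) = (\<Sum>(v, c)\<leftarrow>zip vs cs. E (K v) (\<lambda>s. h s c))"
  using assms
proof (induction vs cs rule: list_induct2)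
  case (Cons v vs c cs)
  have "E (list_pmf (map K (v # vs))) (\<lambda>ss. \<Sum>(s, c)\<leftarrow>zip ss (c # cs). h s c)
     = E (K v) (\<lambda>s. E (list_pmf (map K vs)) (\<lambda>ss. h s c + (\<Sum>(s, c)\<leftarrow>zip ss cs. h s c)))"
    by (simp, subst expectation_bind_pmf_finite) (auto simp: finite_set_list_pmf)
  also have "\<dots> = E (K v) (\<lambda>s. h s c) + (\<Sum>(v, c)\<leftarrow>zip vs cs. E (K v) (\<lambda>s. h s c))"
    by (simp add: integrable_measure_pmf_finite finite_set_list_pmf Cons.IH)
  finally show ?case by simp
qed simp

section \<open>Single-letter ratios and the source\<close>

text \<open>On laws of ((x, y), a), the shape of both test channels, this is I(X; A | Y).\<close>

abbreviation "cmi J \<equiv> cond_mutual_info J (\<lambda>w. fst (fst w)) snd (\<lambda>w. snd (fst w))"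
abbreviation "ratio J \<equiv> info_ratio J (\<lambda>w. fst (fst w)) snd (\<lambda>w. snd (fst w))"

lemma map_comp_fst_test_joint: "map_pmf (\<lambda>w. f (fst w)) (test_joint p W) = map_pmf f p"
  using arg_cong[OF map_fst_test_joint[of p W], of "map_pmf f"] by (simp add: pmf.map_comp o_def)

lemma ratio_eq:
  "ratio J ((x, y), a) = pmf J ((x, y), a) * pmf (map_pmf (\<lambda>w. snd (fst w)) J) y /
     (pmf (map_pmf fst J) (x, y) * pmf (map_pmf (\<lambda>w. (snd (fst w), snd w)) J) (y, a))"
proof -
  have "pmf (map_pmf (\<lambda>w. (fst (fst w), snd w, snd (fst w))) J) ((\<lambda>w. (fst (fst w), snd w, snd (fst w))) ((x, y), a)) = pmf J ((x, y), a)"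
    by (rule pmf_map_inj') (auto simp: inj_on_def)
  moreover have "pmf (map_pmf prod.swap (map_pmf (\<lambda>w. (snd (fst w), snd w)) J)) (prod.swap (y, a)) =
    pmf (map_pmf (\<lambda>w. (snd (fst w), snd w)) J) (y, a)"
    by (rule pmf_map_inj') auto
  moreover have "(\<lambda>w. (fst (fst w), snd (fst w))) = (fst :: ('a \<times> 'b) \<times> 'c \<Rightarrow> _)" by auto
  ultimately show ?thesis
    unfolding info_ratio_def by (simp add: pmf.map_comp o_def)
qed

text \<open>\<open>q\<close> is the conditional law of the output given y. Where \<open>W\<close> is
  positive the ratio is W(a|x,y) / q(a|y) and equality holds. Where \<open>W\<close> vanishes the
  ratio is 0 and its \<open>log\<close> is 0 by convention, so in general there is only an
  inequality.\<close>

lemma kernel_le_ratio: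
  fixes p :: "('x \<times> 'y) pmf" and W :: "'x \<times> 'y \<Rightarrow> 'a pmf"
  defines "J \<equiv> test_joint p W"
  assumes xy: "(x, y) \<in> set_pmf p"
    and q: "map_pmf (\<lambda>w. (snd (fst w), snd w)) J = test_joint (map_pmf snd p) q"
  shows "pmf (W (x, y)) a \<le> 2 powr log 2 (ratio J ((x, y), a)) * pmf (q y) a"
proof (cases "pmf (W (x, y)) a = 0")
  case False
  then have W: "pmf (W (x, y)) a > 0" by (simp add: pmf_nonneg order_less_le)
  have p: "pmf p (x, y) > 0" using xy by (simp add: pmf_positive)
  have pY: "pmf (map_pmf snd p) y > 0" using pmf_map_pos[OF xy, of snd] by simp
  have J: "pmf J ((x, y), a) = pmf p (x, y) * pmf (W (x, y)) a" by (simp add: J_def pmf_test_joint)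
  then have J0: "((x, y), a) \<in> set_pmf J" using p W by (simp add: set_pmf_iff)
  have C: "map_pmf (\<lambda>w. snd (fst w)) J = map_pmf snd p"
    unfolding J_def by (rule map_comp_fst_test_joint)
  have Q: "pmf (map_pmf (\<lambda>w. (snd (fst w), snd w)) J) (y, a) = pmf (map_pmf snd p) y * pmf (q y) a"
    unfolding q by (rule pmf_test_joint)
  moreover have "pmf (map_pmf (\<lambda>w. (snd (fst w), snd w)) J) (y, a) > 0"
    using pmf_map_pos[OF J0, of "\<lambda>w. (snd (fst w), snd w)"] by simp
  ultimately have q0: "pmf (q y) a > 0" using pY by (simp add: zero_less_mult_iff)
  have "ratio J ((x, y), a) = pmf (W (x, y)) a / pmf (q y) a"
    unfolding ratio_eq J C Q using p pY by (simp add: J_def map_fst_test_joint field_simps)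
  then show ?thesis using W q0 by simp
qed simp

text \<open>The posterior of x given (y, a) sums to 1, or to 0 by division by zero if (y, a) has no
  mass.\<close>

lemma sum_posterior_le_1:
  fixes J :: "(('x :: finite \<times> 'y :: finite) \<times> 'a :: finite) pmf"
  shows "(\<Sum>x\<in>UNIV. pmf J ((x, y), a) / pmf (map_pmf (\<lambda>w. (snd (fst w), snd w)) J) (y, a)) \<le> 1"
proof -
  have "{w :: ('x \<times> 'y) \<times> 'a. (snd (fst w), snd w) = (y, a)} = (\<lambda>x. ((x, y), a)) ` UNIV" by auto
  then have "pmf (map_pmf (\<lambda>w. (snd (fst w), snd w)) J) (y, a) = (\<Sum>x\<in>UNIV. pmf J ((x, y), a))"
    unfolding pmf_map_sum by (simp add: sum.reindex inj_on_def)
  then show ?thesis by (simp add: sum_divide_distrib[symmetric])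
qed

text \<open>By \<open>markov\<close> the weight p(x1,x2,y) is p(x1,y) p(x2,y) / p(y), which cancels
  the priors in both ratios and leaves p(y) times two posteriors. The sum over (x1, x2) then
  factors.\<close>

lemma sum_ratio_le:
  fixes p :: "('x1 :: finite \<times> 'x2 :: finite \<times> 'y :: finite) pmf"
    and J1 :: "(('x1 \<times> 'y) \<times> 'a :: finite) pmf" and J2 :: "(('x2 \<times> 'y) \<times> 'b :: finite) pmf"
  assumes markov: "\<And>x1 x2 y. pmf p (x1, x2, y) * pmf (map_pmf (\<lambda>v. snd (snd v)) p) y
      = pmf (map_pmf fst J1) (x1, y) * pmf (map_pmf fst J2) (x2, y)"
    and C1: "map_pmf (\<lambda>w. snd (fst w)) J1 = map_pmf (\<lambda>v. snd (snd v)) p"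
    and C2: "map_pmf (\<lambda>w. snd (fst w)) J2 = map_pmf (\<lambda>v. snd (snd v)) p"
  shows "(\<Sum>v | snd (snd v) = y. pmf p v * (ratio J1 ((fst v, snd (snd v)), a) * ratio J2 ((fst (snd v), snd (snd v)), b)))
    \<le> pmf (map_pmf (\<lambda>v. snd (snd v)) p) y"
proof -
  let ?pY = "pmf (map_pmf (\<lambda>v. snd (snd v)) p)"
  let ?u1 = "\<lambda>x. pmf J1 ((x, y), a) / pmf (map_pmf (\<lambda>w. (snd (fst w), snd w)) J1) (y, a)"
  let ?u2 = "\<lambda>x. pmf J2 ((x, y), b) / pmf (map_pmf (\<lambda>w. (snd (fst w), snd w)) J2) (y, b)"
  have pt: "pmf p (x1, x2, y) * (ratio J1 ((x1, y), a) * ratio J2 ((x2, y), b)) \<le> ?pY y * (?u1 x1 * ?u2 x2)" for x1 x2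
  proof (cases "?pY y = 0 \<or> pmf (map_pmf fst J1) (x1, y) = 0 \<or> pmf (map_pmf fst J2) (x2, y) = 0")
    case True
    \<comment> \<open>In each of these cases a ratio is 0: its numerator contains p(y), or its
      denominator is 0.\<close>
    have "pmf p (x1, x2, y) = 0 \<or> ratio J1 ((x1, y), a) = 0 \<or> ratio J2 ((x2, y), b) = 0"
      using True unfolding ratio_eq C1 C2 by auto
    then have "pmf p (x1, x2, y) * (ratio J1 ((x1, y), a) * ratio J2 ((x2, y), b)) = 0" by auto
    moreover have "0 \<le> ?pY y * (?u1 x1 * ?u2 x2)" by simp
    ultimately show ?thesis by linarith
  next
    case False
    then have "pmf p (x1, x2, y) = pmf (map_pmf fst J1) (x1, y) * pmf (map_pmf fst J2) (x2, y) / ?pY y"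
      using markov[of x1 x2 y] by (simp add: field_simps)
    then have "pmf p (x1, x2, y) * (ratio J1 ((x1, y), a) * ratio J2 ((x2, y), b)) = ?pY y * (?u1 x1 * ?u2 x2)"
      unfolding ratio_eq C1 C2 using False by simp
    then show ?thesis by simp
  qed
  have eq: "{v :: 'x1 \<times> 'x2 \<times> 'y. snd (snd v) = y} = (\<lambda>(x1, x2). (x1, x2, y)) ` (UNIV \<times> UNIV)"
    by force
  have "(\<Sum>v | snd (snd v) = y. pmf p v * (ratio J1 ((fst v, snd (snd v)), a) * ratio J2 ((fst (snd v), snd (snd v)), b)))
    = (\<Sum>(x1, x2)\<in>UNIV \<times> UNIV. pmf p (x1, x2, y) * (ratio J1 ((x1, y), a) * ratio J2 ((x2, y), b)))"
    unfolding eq by (subst sum.reindex) (auto simp: inj_on_def case_prod_unfold)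
  also have "\<dots> \<le> (\<Sum>(x1, x2)\<in>UNIV \<times> UNIV. ?pY y * (?u1 x1 * ?u2 x2))"
    using pt by (intro sum_mono) auto
  also have "\<dots> = ?pY y * ((\<Sum>x\<in>UNIV. ?u1 x) * (\<Sum>x\<in>UNIV. ?u2 x))"
    by (subst sum_product) (simp only: sum.cartesian_product sum_distrib_left case_prod_unfold)
  also have "\<dots> \<le> ?pY y * (1 * 1)"
    by (intro mult_left_mono mult_mono sum_posterior_le_1 sum_nonneg) auto
  finally show ?thesis by simp
qed

section \<open>The source: the Markov condition in product form and the elimination of the hidden
  letter\<close>

lemma X1_of_eq: "X1_of = (\<lambda>w. fst (snd w))" by (simp add: fun_eq_iff)
lemma X2_of_eq: "X2_of = (\<lambda>w. fst (snd (snd w)))" by (simp add: fun_eq_iff)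
lemma Y_of_eq: "Y_of = (\<lambda>w. snd (snd (snd w)))" by (simp add: fun_eq_iff)
lemma S_of_eq: "S_of = (\<lambda>w. fst w)" by (simp add: fun_eq_iff)
lemmas of_eqs = X1_of_eq X2_of_eq Y_of_eq S_of_eq

text \<open>Multiplication by p(y)^2 clears the conditional probabilities; if p(y) = 0 both sides
  vanish, as p(x1,y) \<le> p(y).\<close>

lemma markov_chain_pmf:
  fixes P :: "('s \<times> 'x1 \<times> 'x2 \<times> 'y) pmf"
  defines "p \<equiv> map_pmf snd P"
  assumes "markov_chain P X1_of Y_of X2_of"
  shows "pmf p (x1, x2, y) * pmf (map_pmf (\<lambda>v. snd (snd v)) p) y =
    pmf (map_pmf (\<lambda>v. (fst v, snd (snd v))) p) (x1, y) * pmf (map_pmf (\<lambda>v. (fst (snd v), snd (snd v))) p) (x2, y)"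
proof -
  let ?m = "\<lambda>A. measure_pmf.prob P {w. A w}"
  have 1: "pmf p (x1, x2, y) = ?m (\<lambda>w. (X1_of w = x1 \<and> X2_of w = x2) \<and> Y_of w = y)"
    "pmf (map_pmf (\<lambda>v. snd (snd v)) p) y = ?m (\<lambda>w. Y_of w = y)"
    "pmf (map_pmf (\<lambda>v. (fst v, snd (snd v))) p) (x1, y) = ?m (\<lambda>w. X1_of w = x1 \<and> Y_of w = y)"
    "pmf (map_pmf (\<lambda>v. (fst (snd v), snd (snd v))) p) (x2, y) = ?m (\<lambda>w. X2_of w = x2 \<and> Y_of w = y)"
    unfolding p_def pmf.map_comp pmf_map of_eqs vimage_def
    by (intro arg_cong[where f = "measure_pmf.prob P"]; auto simp: prod_eq_iff)+
  have c: "?m (\<lambda>w. (X1_of w = x1 \<and> X2_of w = x2) \<and> Y_of w = y) / ?m (\<lambda>w. Y_of w = y)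
    = ?m (\<lambda>w. X1_of w = x1 \<and> Y_of w = y) / ?m (\<lambda>w. Y_of w = y) * (?m (\<lambda>w. X2_of w = x2 \<and> Y_of w = y) / ?m (\<lambda>w. Y_of w = y))"
    using assms(2) unfolding markov_chain_def cond_prob_def by simp
  show ?thesis
  proof (cases "?m (\<lambda>w. Y_of w = y) = 0")
    case True
    have "?m (\<lambda>w. X1_of w = x1 \<and> Y_of w = y) \<le> ?m (\<lambda>w. Y_of w = y)"
      by (intro measure_pmf.finite_measure_mono) auto
    then have "?m (\<lambda>w. X1_of w = x1 \<and> Y_of w = y) = 0" using True by (simp add: measure_le_0_iff)
    then show ?thesis unfolding 1 True by simp
  next
    case False
    with c show ?thesis unfolding 1 by (simp add: field_simps)
  qed
qed

text \<open>Reads \<open>factorizes\<close> as a sampling scheme: draw (x1, x2, y), then s from x1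
  alone. The swap restores the order in which s comes first.\<close>

lemma source_eq_test_joint:
  fixes P :: "('s \<times> 'x1 \<times> 'x2 \<times> 'y) pmf"
  assumes "factorizes P"
  shows "\<exists>K :: 'x1 \<Rightarrow> 's pmf. P = map_pmf prod.swap (test_joint (map_pmf snd P) (\<lambda>v. K (fst v)))"
proof -
  obtain K :: "'x1 \<Rightarrow> 's pmf" where K: "\<And>s x1 x2 y. pmf P (s, x1, x2, y)
     = pmf (map_pmf (\<lambda>w. (X1_of w, X2_of w, Y_of w)) P) (x1, x2, y) * pmf (K x1) s"
    using assms unfolding factorizes_def by blast
  have "P = map_pmf prod.swap (test_joint (map_pmf snd P) (\<lambda>v. K (fst v)))" (is "P = map_pmf prod.swap ?Q")
  proof (rule pmf_eqI)
    fix w :: "'s \<times> 'x1 \<times> 'x2 \<times> 'y"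
    obtain s v where w: "w = prod.swap (v, s)" by (metis swap_swap surj_pair)
    have "pmf (map_pmf prod.swap ?Q) w = pmf ?Q (v, s)"
      unfolding w by (rule pmf_map_inj') auto
    also have "\<dots> = pmf P w"
      using K[of s "fst v" "fst (snd v)" "snd (snd v)"]
      by (simp add: w pmf_test_joint of_eqs)
    finally show "pmf P w = pmf (map_pmf prod.swap ?Q) w" ..
  qed
  then show ?thesis by blast
qed

text \<open>\<open>ds'\<close> is the conditional mean of \<open>ds\<close> given x1. The assumption
  on \<open>v\<close> excludes p(x1) = 0, where \<open>ds'\<close> degenerates to 0.\<close>

lemma ds'_eq_expectation:
  fixes P :: "('s :: finite \<times> 'x1 \<times> 'x2 \<times> 'y) pmf"
  assumes P: "P = map_pmf prod.swap (test_joint (map_pmf snd P) (\<lambda>v. K (fst v)))"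
    and v: "v \<in> set_pmf (map_pmf snd P)"
  shows "ds' P ds (fst v) b = E (K (fst v)) (\<lambda>s. ds s b)"
proof -
  let ?p = "map_pmf snd P"
  have "map_pmf (\<lambda>w. (X1_of w, S_of w)) P = map_pmf (\<lambda>w. (X1_of w, S_of w)) (map_pmf prod.swap (test_joint ?p (\<lambda>v. K (fst v))))"
    using P by simp
  also have "\<dots> = test_joint (map_pmf fst ?p) K"
    by (simp add: test_joint_def of_eqs map_bind_pmf bind_map_pmf pmf.map_comp o_def)
  finally have 1: "pmf (map_pmf (\<lambda>w. (X1_of w, S_of w)) P) (x, s) = pmf (map_pmf fst ?p) x * pmf (K x) s" for x s
    by (simp add: pmf_test_joint)
  have 2: "map_pmf X1_of P = map_pmf fst ?p" by (simp add: pmf.map_comp o_def of_eqs cong: map_pmf_cong)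
  have 3: "pmf (map_pmf fst ?p) (fst v) > 0" by (rule pmf_map_pos[OF v])
  show ?thesis
    unfolding ds'_def 1 2 expectation_finite_sum using 3
    by (simp add: sum_distrib_left)
qed

text \<open>The reconstruction \<open>\<psi>\<close> depends on \<open>map snd ws\<close> only.
  Given these letters the hidden ones are independent with laws \<open>K x1\<close>, so the
  conditional expectation can be taken term by term.\<close>

lemma expectation_source:
  fixes P :: "('s :: finite \<times> 'x1 :: finite \<times> 'x2 :: finite \<times> 'y :: finite) pmf" and h :: "'s \<Rightarrow> 'a \<Rightarrow> real"
  assumes P: "P = map_pmf prod.swap (test_joint (map_pmf snd P) (\<lambda>v. K (fst v)))"
    and len: "\<And>vs. length vs = n \<Longrightarrow> length (\<psi> vs) = n"
  shows "E (replicate_pmf n P) (\<lambda>ws. (\<Sum>w\<leftarrow>zip ws (\<psi> (map snd ws)). h (fst (fst w)) (snd w)) / n)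
     = E (replicate_pmf n (map_pmf snd P)) (\<lambda>vs. (\<Sum>w\<leftarrow>zip vs (\<psi> vs). E (K (fst (fst w))) (\<lambda>s. h s (snd w))) / n)"
proof -
  let ?p = "map_pmf snd P"
  let ?F = "\<lambda>ws. (\<Sum>w\<leftarrow>zip ws (\<psi> (map snd ws)). h (fst (fst w)) (snd w)) / n"
  have z: "(\<Sum>w\<leftarrow>zip (map prod.swap (zip vs ss)) cs. h (fst (fst w)) (snd w)) = (\<Sum>(s, c)\<leftarrow>zip ss cs. h s c)"
    if "length vs = length ss" "length ss = length cs" for vs :: "('x1 \<times> 'x2 \<times> 'y) list" and ss cs
    using that by (induction vs ss cs rule: list_induct3) auto
  have "E (replicate_pmf n P) ?F = E (map_pmf (map prod.swap) (replicate_pmf n (test_joint ?p (\<lambda>v. K (fst v))))) ?F"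
    unfolding map_replicate_pmf using P by simp
  also have "\<dots> = E (replicate_pmf n ?p) (\<lambda>vs. E (list_pmf (map (\<lambda>v. K (fst v)) vs)) (\<lambda>ss. ?F (map prod.swap (zip vs ss))))"
    unfolding replicate_pmf_test_joint map_bind_pmf
    by (subst expectation_bind_pmf_finite) (auto simp: finite_set_replicate_pmf finite_set_list_pmf)
  also have "\<dots> = E (replicate_pmf n ?p) (\<lambda>vs. (\<Sum>w\<leftarrow>zip vs (\<psi> vs). E (K (fst (fst w))) (\<lambda>s. h s (snd w))) / n)"
  proof (rule expectation_cong_set_pmf)
    fix vs assume "vs \<in> set_pmf (replicate_pmf n ?p)"
    then have l: "length vs = n" by (rule length_of_set_replicate_pmf)
    let ?L = "list_pmf (map (\<lambda>v. K (fst v)) vs)"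
    have "E ?L (\<lambda>ss. ?F (map prod.swap (zip vs ss))) = E ?L (\<lambda>ss. (\<Sum>(s, c)\<leftarrow>zip ss (\<psi> vs). h s c) / n)"
    proof (rule expectation_cong_set_pmf)
      fix ss assume "ss \<in> set_pmf ?L"
      then have ss: "length vs = length ss" using length_of_set_list_pmf by fastforce
      then have "map snd (map prod.swap (zip vs ss)) = vs" by (simp add: o_def)
      then show "?F (map prod.swap (zip vs ss)) = (\<Sum>(s, c)\<leftarrow>zip ss (\<psi> vs). h s c) / n"
        using z[OF ss, of "\<psi> vs"] ss l len by simp
    qed
    also have "\<dots> = (\<Sum>(v, c)\<leftarrow>zip vs (\<psi> vs). E (K (fst v)) (\<lambda>s. h s c)) / n"
      using l len by (simp add: expectation_list_pmf_zip)
    finally show "E ?L (\<lambda>ss. ?F (map prod.swap (zip vs ss))) = (\<Sum>w\<leftarrow>zip vs (\<psi> vs). E (K (fst (fst w))) (\<lambda>s. h s (snd w))) / n"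
      by (simp add: case_prod_unfold)
  qed
  finally show ?thesis .
qed

section \<open>Codes\<close>

text \<open>A code as one map from words of source triples to words of reconstruction triples, the
  form on which \<open>avg_joint\<close> operates. For a code the three output words have equal
  length, so zipping loses nothing.\<close>

definition code_output ::
  "('x1, 'x2, 'y) encoder \<Rightarrow> ('y, 'a1, 'a2, 'b) decoder \<Rightarrow> ('x1 \<times> 'x2 \<times> 'y) list \<Rightarrow> ('a1 \<times> 'a2 \<times> 'b) list" where
  "code_output enc dec vs =
     (case dec (enc (map fst vs, map (\<lambda>v. fst (snd v)) vs, map (\<lambda>v. snd (snd v)) vs), map (\<lambda>v. snd (snd v)) vs) of
       (as1, as2, bs) \<Rightarrow> zip as1 (zip as2 bs))"

lemma code_enc_messages:
  assumes "is_code n R enc dec" "length vs = n"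
  shows "enc (map fst vs, map (\<lambda>v. fst (snd v)) vs, map (\<lambda>v. snd (snd v)) vs) \<in> messages n R"
proof -
  have "(map fst vs, map (\<lambda>v. fst (snd v)) vs, map (\<lambda>v. snd (snd v)) vs) \<in> seqs n \<times> seqs n \<times> seqs n"
    using assms(2) by (simp add: seqs_def)
  then show ?thesis using assms(1) unfolding is_code_def by blast
qed

lemma code_dec_length:
  assumes "is_code n R enc dec" "length vs = n"
  shows "\<exists>as1 as2 bs. dec (enc (map fst vs, map (\<lambda>v. fst (snd v)) vs, map (\<lambda>v. snd (snd v)) vs), map (\<lambda>v. snd (snd v)) vs)
    = (as1, as2, bs) \<and> length as1 = n \<and> length as2 = n \<and> length bs = n"
proof -
  let ?t = "(map fst vs, map (\<lambda>v. fst (snd v)) vs, map (\<lambda>v. snd (snd v)) vs)"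
  have "(enc ?t, map (\<lambda>v. snd (snd v)) vs) \<in> messages n R \<times> seqs n"
    using assms(2) code_enc_messages[OF assms] by (simp add: seqs_def)
  then have "dec (enc ?t, map (\<lambda>v. snd (snd v)) vs) \<in> seqs n \<times> seqs n \<times> seqs n"
    using assms(1) unfolding is_code_def by blast
  then show ?thesis by (auto simp: seqs_def)
qed

lemma length_code_output:
  assumes "is_code n R enc dec" "length vs = n"
  shows "length (code_output enc dec vs) = n"
  using code_dec_length[OF assms] by (auto simp: code_output_def)

lemma reconstruct_code_output:
  assumes "is_code n R enc dec" "length ws = n"
  shows "reconstruct enc dec ws = (map fst (code_output enc dec (map snd ws)),
     map (\<lambda>c. fst (snd c)) (code_output enc dec (map snd ws)), map (\<lambda>c. snd (snd c)) (code_output enc dec (map snd ws)))"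
proof -
  have *: "map X1_of ws = map fst (map snd ws)" "map X2_of ws = map (\<lambda>v. fst (snd v)) (map snd ws)"
    "map Y_of ws = map (\<lambda>v. snd (snd v)) (map snd ws)"
    by (simp_all add: of_eqs)
  obtain as1 as2 bs where d: "dec (enc (map fst (map snd ws), map (\<lambda>v. fst (snd v)) (map snd ws), map (\<lambda>v. snd (snd v)) (map snd ws)),
      map (\<lambda>v. snd (snd v)) (map snd ws)) = (as1, as2, bs)" "length as1 = n" "length as2 = n" "length bs = n"
    using code_dec_length[OF assms(1), of "map snd ws"] assms(2) by auto
  have "map fst (zip as1 (zip as2 bs)) = as1" using d by simp
  moreover have "map (\<lambda>c. fst (snd c)) (zip as1 (zip as2 bs)) = map fst (map snd (zip as1 (zip as2 bs)))"
    "map (\<lambda>c. snd (snd c)) (zip as1 (zip as2 bs)) = map snd (map snd (zip as1 (zip as2 bs)))" by simp_all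
  moreover have "map snd (zip as1 (zip as2 bs)) = zip as2 bs" using d by simp
  ultimately show ?thesis
    unfolding reconstruct_def code_output_def * d(1) using d(2-4) by simp
qed

lemma seq_dist_zip:
  assumes "length vs = n" "length cs = n"
  shows "seq_dist d n (map X vs) (map Z cs) = (\<Sum>w\<leftarrow>zip vs cs. d (X (fst w)) (Z (snd w))) / n"
proof -
  have "(\<Sum>w\<leftarrow>zip vs cs. d (X (fst w)) (Z (snd w))) = (\<Sum>i<n. d (map X vs ! i) (map Z cs ! i))"
    unfolding sum_list_sum_nth using assms by (intro sum.cong) auto
  then show ?thesis by (simp add: seq_dist_def)
qed

definition mean_output ::
  "nat \<Rightarrow> 'v pmf \<Rightarrow> ('v list \<Rightarrow> 'c list) \<Rightarrow> ('v \<times> 'c \<Rightarrow> real) \<Rightarrow> real" where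
  "mean_output n p \<phi> f = E (replicate_pmf n p) (\<lambda>vs. (\<Sum>w\<leftarrow>zip vs (\<phi> vs). f w) / n)"

text \<open>All three expectations become averages of letter functions under the block law of (x1,
  x2, y); in the third the hidden letter is integrated out.\<close>

lemma expectation_distortions:
  fixes P :: "('s :: finite \<times> 'x1 :: finite \<times> 'x2 :: finite \<times> 'y :: finite) pmf"
    and d1 :: "'x1 \<Rightarrow> 'a1 \<Rightarrow> real" and d2 :: "'x2 \<Rightarrow> 'a2 \<Rightarrow> real" and ds :: "'s \<Rightarrow> 'b \<Rightarrow> real"
  assumes fact: "factorizes P" and code: "is_code n R enc dec"
  shows "E (replicate_pmf n P) (\<lambda>ws. case reconstruct enc dec ws of (as1, as2, bs) \<Rightarrow> seq_dist d1 n (map X1_of ws) as1)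
      = mean_output n (map_pmf snd P) (code_output enc dec) (\<lambda>w. d1 (fst (fst w)) (fst (snd w)))" (is ?D1)
    and "E (replicate_pmf n P) (\<lambda>ws. case reconstruct enc dec ws of (as1, as2, bs) \<Rightarrow> seq_dist d2 n (map X2_of ws) as2)
      = mean_output n (map_pmf snd P) (code_output enc dec) (\<lambda>w. d2 (fst (snd (fst w))) (fst (snd (snd w))))" (is ?D2)
    and "E (replicate_pmf n P) (\<lambda>ws. case reconstruct enc dec ws of (as1, as2, bs) \<Rightarrow> seq_dist ds n (map S_of ws) bs)
      = mean_output n (map_pmf snd P) (code_output enc dec) (\<lambda>w. ds' P ds (fst (fst w)) (snd (snd (snd w))))" (is ?Ds)
proof -
  let ?p = "map_pmf snd P" and ?\<phi> = "code_output enc dec"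
  have len: "length (?\<phi> vs) = n" if "length vs = n" for vs by (rule length_code_output[OF code that])
  show ?D1
    unfolding mean_output_def map_replicate_pmf[symmetric] integral_map_pmf
  proof (rule expectation_cong_set_pmf)
    fix ws assume "ws \<in> set_pmf (replicate_pmf n P)"
    then have l: "length ws = n" by (rule length_of_set_replicate_pmf)
    show "(case reconstruct enc dec ws of (as1, as2, bs) \<Rightarrow> seq_dist d1 n (map X1_of ws) as1)
      = (\<Sum>w\<leftarrow>zip (map snd ws) (?\<phi> (map snd ws)). d1 (fst (fst w)) (fst (snd w))) / n"
      using seq_dist_zip[of "map snd ws" n "?\<phi> (map snd ws)" d1 fst fst] l len
      by (simp add: reconstruct_code_output[OF code l] of_eqs o_def)
  qed
  show ?D2
    unfolding mean_output_def map_replicate_pmf[symmetric] integral_map_pmf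
  proof (rule expectation_cong_set_pmf)
    fix ws assume "ws \<in> set_pmf (replicate_pmf n P)"
    then have l: "length ws = n" by (rule length_of_set_replicate_pmf)
    show "(case reconstruct enc dec ws of (as1, as2, bs) \<Rightarrow> seq_dist d2 n (map X2_of ws) as2)
      = (\<Sum>w\<leftarrow>zip (map snd ws) (?\<phi> (map snd ws)). d2 (fst (snd (fst w))) (fst (snd (snd w)))) / n"
      using seq_dist_zip[of "map snd ws" n "?\<phi> (map snd ws)" d2 "\<lambda>v. fst (snd v)" "\<lambda>c. fst (snd c)"] l len
      by (simp add: reconstruct_code_output[OF code l] of_eqs o_def)
  qed
  obtain K where K: "P = map_pmf prod.swap (test_joint ?p (\<lambda>v. K (fst v)))"
    using source_eq_test_joint[OF fact] by blast
  have "E (replicate_pmf n P) (\<lambda>ws. case reconstruct enc dec ws of (as1, as2, bs) \<Rightarrow> seq_dist ds n (map S_of ws) bs)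
    = E (replicate_pmf n P) (\<lambda>ws. (\<Sum>w\<leftarrow>zip ws (?\<phi> (map snd ws)). ds (fst (fst w)) (snd (snd (snd w)))) / n)"
  proof (rule expectation_cong_set_pmf)
    fix ws assume "ws \<in> set_pmf (replicate_pmf n P)"
    then have l: "length ws = n" by (rule length_of_set_replicate_pmf)
    show "(case reconstruct enc dec ws of (as1, as2, bs) \<Rightarrow> seq_dist ds n (map S_of ws) bs)
      = (\<Sum>w\<leftarrow>zip ws (?\<phi> (map snd ws)). ds (fst (fst w)) (snd (snd (snd w)))) / n"
      using seq_dist_zip[of ws n "?\<phi> (map snd ws)" ds fst "\<lambda>c. snd (snd c)"] l len
      by (simp add: reconstruct_code_output[OF code l] of_eqs o_def)
  qed
  also have "\<dots> = E (replicate_pmf n ?p) (\<lambda>vs. (\<Sum>w\<leftarrow>zip vs (?\<phi> vs). E (K (fst (fst w))) (\<lambda>s. ds s (snd (snd (snd w))))) / n)"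
    by (rule expectation_source[OF K len, where h = "\<lambda>s c. ds s (snd (snd c))"])
  also have "\<dots> = mean_output n ?p ?\<phi> (\<lambda>w. ds' P ds (fst (fst w)) (snd (snd (snd w))))"
    unfolding mean_output_def
  proof (rule expectation_cong_set_pmf)
    fix vs assume vs: "vs \<in> set_pmf (replicate_pmf n ?p)"
    have "E (K (fst (fst w))) (\<lambda>s. ds s (snd (snd (snd w)))) = ds' P ds (fst (fst w)) (snd (snd (snd w)))"
      if "w \<in> set (zip vs (?\<phi> vs))" for w
    proof -
      have "fst w \<in> set vs" using that by (metis set_zip_leftD prod.collapse)
      then have "fst w \<in> set_pmf ?p" using vs by (auto simp only: set_replicate_pmf lists_eq_set)
      then show ?thesis by (rule ds'_eq_expectation[OF K, symmetric])
    qed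
    then show "(\<Sum>w\<leftarrow>zip vs (?\<phi> vs). E (K (fst (fst w))) (\<lambda>s. ds s (snd (snd (snd w))))) / n =
      (\<Sum>w\<leftarrow>zip vs (?\<phi> vs). ds' P ds (fst (fst w)) (snd (snd (snd w)))) / n"
      by (simp cong: map_cong)
  qed
  finally show ?Ds .
qed

definition proj1 :: "('x1 \<times> 'x2 \<times> 'y) \<times> ('a1 \<times> 'a2 \<times> 'b) \<Rightarrow> ('x1 \<times> 'y) \<times> ('a1 \<times> 'b)" where
  "proj1 w = ((fst (fst w), snd (snd (fst w))), (fst (snd w), snd (snd (snd w))))"

definition proj2 :: "('x1 \<times> 'x2 \<times> 'y) \<times> ('a1 \<times> 'a2 \<times> 'b) \<Rightarrow> ('x2 \<times> 'y) \<times> 'a2" where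
  "proj2 w = ((fst (snd (fst w)), snd (snd (fst w))), fst (snd (snd w)))"

lemma card_messages: "card (messages n R) = nat \<lfloor>2 powr (real n * R)\<rfloor>" "finite (messages n R)"
  by (simp_all add: messages_def)

text \<open>Both informations are taken under one averaged law, so the mean of the logarithm of
  \<open>?g\<close> is their sum. The same mean is an average over the block, which
  \<open>expectation_log_ratio_le\<close> bounds through the number of messages.\<close>

lemma converse_single:
  fixes p :: "('x1 :: finite \<times> 'x2 :: finite \<times> 'y :: finite) pmf"
    and enc :: "('x1, 'x2, 'y) encoder" and dec :: "('y, 'a1 :: finite, 'a2 :: finite, 'b :: finite) decoder"
  assumes n: "n > 0" and R: "0 \<le> R" and code: "is_code n R enc dec"
    and markov: "\<And>x1 x2 y. pmf p (x1, x2, y) * pmf (map_pmf (\<lambda>v. snd (snd v)) p) y =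
      pmf (map_pmf (\<lambda>v. (fst v, snd (snd v))) p) (x1, y) * pmf (map_pmf (\<lambda>v. (fst (snd v), snd (snd v))) p) (x2, y)"
  shows "cmi (map_pmf proj1 (avg_joint n p (code_output enc dec))) + cmi (map_pmf proj2 (avg_joint n p (code_output enc dec))) \<le> R"
proof -
  let ?\<phi> = "code_output enc dec" and ?K = "avg_joint n p (code_output enc dec)"
  let ?J1 = "map_pmf proj1 ?K" and ?J2 = "map_pmf proj2 ?K"
  let ?Y = "\<lambda>v :: 'x1 \<times> 'x2 \<times> 'y. snd (snd v)"
  let ?g = "\<lambda>v a. ratio ?J1 (proj1 (v, a)) * ratio ?J2 (proj2 (v, a))"
  let ?M = "nat \<lfloor>2 powr (real n * R)\<rfloor>"
  have len: "length (?\<phi> vs) = n" if "length vs = n" for vs by (rule length_code_output[OF code that])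
  have mK: "map_pmf fst ?K = p" by (rule map_fst_avg_joint[OF n len])
  have mK': "map_pmf (\<lambda>w. f (fst w)) ?K = map_pmf f p" for f :: "'x1 \<times> 'x2 \<times> 'y \<Rightarrow> 'z"
    using arg_cong[OF mK, where f = "map_pmf f"] by (simp add: pmf.map_comp o_def)
  have "1 \<le> 2 powr (real n * R)" using R by (simp add: ge_one_powr_ge_zero)
  then have M: "0 < ?M" "real ?M \<le> 2 powr (real n * R)" by linarith+
  have pos1: "0 < ratio ?J1 (proj1 w)" "0 < ratio ?J2 (proj2 w)" if "w \<in> set_pmf ?K" for w
    using that by (auto intro!: info_ratio_pos)
  have "E (replicate_pmf n p) (\<lambda>vs. \<Sum>(v, a)\<leftarrow>zip vs (?\<phi> vs). log 2 (?g v a)) \<le> log 2 ?M"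
  proof (rule expectation_log_ratio_le[where Y = ?Y, OF _ _ len])
    show "0 \<le> ?g v a" for v a by (simp add: info_ratio_def)
    show "(\<Sum>v | ?Y v = y. pmf p v * ?g v a) \<le> pmf (map_pmf ?Y p) y" for y a
    proof -
      have eq: "(\<Sum>v | ?Y v = y. pmf p v * ?g v a) = (\<Sum>v | ?Y v = y. pmf p v *
         (ratio ?J1 ((fst v, snd (snd v)), (fst a, snd (snd a))) * ratio ?J2 ((fst (snd v), snd (snd v)), fst (snd a))))"
        by (simp add: proj1_def proj2_def)
      show ?thesis
        unfolding eq
      proof (rule sum_ratio_le)
        have "map_pmf fst ?J1 = map_pmf (\<lambda>v. (fst v, snd (snd v))) p"
          using mK'[of "\<lambda>v. (fst v, snd (snd v))"] by (simp add: pmf.map_comp o_def proj1_def)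
        moreover have "map_pmf fst ?J2 = map_pmf (\<lambda>v. (fst (snd v), snd (snd v))) p"
          using mK'[of "\<lambda>v. (fst (snd v), snd (snd v))"] by (simp add: pmf.map_comp o_def proj2_def)
        ultimately show "pmf p (x1, x2, y) * pmf (map_pmf ?Y p) y = pmf (map_pmf fst ?J1) (x1, y) * pmf (map_pmf fst ?J2) (x2, y)"
          for x1 x2 y using markov by simp
        show "map_pmf (\<lambda>w. snd (fst w)) ?J1 = map_pmf ?Y p"
          using mK'[of ?Y] by (simp add: pmf.map_comp o_def proj1_def)
        show "map_pmf (\<lambda>w. snd (fst w)) ?J2 = map_pmf ?Y p"
          using mK'[of ?Y] by (simp add: pmf.map_comp o_def proj2_def)
      qed
    qed
    \<comment> \<open>For given \<open>ys\<close> the output is a function of the message, so there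
      are at most as many outputs as messages.\<close>
    show "card (?\<phi> ` {vs. map ?Y vs = ys}) \<le> ?M" if ys: "length ys = n" for ys
    proof -
      let ?D = "\<lambda>m. case dec (m, ys) of (as1, as2, bs) \<Rightarrow> zip as1 (zip as2 bs)"
      have "?\<phi> ` {vs. map ?Y vs = ys} \<subseteq> ?D ` messages n R"
      proof safe
        fix vs assume vs: "ys = map ?Y vs"
        then have "enc (map fst vs, map (\<lambda>v. fst (snd v)) vs, map ?Y vs) \<in> messages n R"
          using code_enc_messages[OF code, of vs] ys by simp
        moreover have "?\<phi> vs = (\<lambda>m. case dec (m, map ?Y vs) of (as1, as2, bs) \<Rightarrow> zip as1 (zip as2 bs))
            (enc (map fst vs, map (\<lambda>v. fst (snd v)) vs, map ?Y vs))"
          by (simp add: code_output_def)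
        ultimately show "?\<phi> vs \<in> (\<lambda>m. case dec (m, map ?Y vs) of (as1, as2, bs) \<Rightarrow> zip as1 (zip as2 bs)) ` messages n R"
          by blast
      qed
      then have "card (?\<phi> ` {vs. map ?Y vs = ys}) \<le> card (?D ` messages n R)"
        by (rule card_mono[OF finite_imageI[OF card_messages(2)]])
      also have "\<dots> \<le> card (messages n R)" by (rule card_image_le[OF card_messages(2)])
      finally show ?thesis unfolding card_messages(1) .
    qed
    show "0 < ?g v a" if "vs \<in> set_pmf (replicate_pmf n p)" "(v, a) \<in> set (zip vs (?\<phi> vs))" for vs v a
      using pos1[OF set_avg_joint[where \<phi> = ?\<phi>, OF n that(1) len[OF length_of_set_replicate_pmf[OF that(1)]] that(2)]] by simp
  qed (use M in auto)
  moreover have "log 2 ?M \<le> n * R"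
  proof -
    have "log 2 ?M \<le> log 2 (2 powr (real n * R))" using M by (intro log_mono) auto
    then show ?thesis by simp
  qed
  moreover have "cmi ?J1 + cmi ?J2 = E ?K (\<lambda>w. log 2 (?g (fst w) (snd w)))"
  proof -
    have "cmi ?J1 + cmi ?J2 = E ?K (\<lambda>w. log 2 (ratio ?J1 (proj1 w)) + log 2 (ratio ?J2 (proj2 w)))"
      by (simp add: cond_mutual_info_eq_expectation integrable_measure_pmf_finite)
    also have "\<dots> = E ?K (\<lambda>w. log 2 (?g (fst w) (snd w)))"
      using pos1 by (intro expectation_cong_set_pmf) (simp add: log_mult_pos)
    finally show ?thesis .
  qed
  moreover have "\<dots> = E (replicate_pmf n p) (\<lambda>vs. (\<Sum>w\<leftarrow>zip vs (?\<phi> vs). log 2 (?g (fst w) (snd w))) / n)"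
    by (rule expectation_avg_joint[OF n len])
  moreover have "\<dots> = E (replicate_pmf n p) (\<lambda>vs. \<Sum>(v, a)\<leftarrow>zip vs (?\<phi> vs). log 2 (?g v a)) / n"
    by (simp add: case_prod_unfold)
  ultimately have "cmi ?J1 + cmi ?J2 \<le> n * R / n"
    by (simp only:) (intro divide_right_mono, auto)
  then show ?thesis using n by simp
qed

section \<open>The rate-distortion function\<close>

definition feasible :: "'u pmf \<Rightarrow> (('u \<times> 'a \<Rightarrow> real) \<times> real) set \<Rightarrow> ('u \<times> 'a) pmf set" where
  "feasible p C = {J. map_pmf fst J = p \<and> (\<forall>(f, D)\<in>C. E J f \<le> D)}"

text \<open>The constraints are imposed on the limits of the expectations, since the averaged laws
  of codes meet the distortion bounds only in the limit.\<close>

lemma feasible_limit: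
  fixes J :: "('u :: finite \<times> 'a :: finite) pmf"
  assumes conv: "\<And>w. (\<lambda>k. pmf (Js k) w) \<longlonglongrightarrow> pmf J w" and marg: "\<And>k. map_pmf fst (Js k) = p"
    and lim: "\<And>f D. (f, D) \<in> C \<Longrightarrow> \<exists>L\<le>D. (\<lambda>k. E (Js k) f) \<longlonglongrightarrow> L"
  shows "J \<in> feasible p C"
proof -
  have "map_pmf fst J = p"
  proof (rule pmf_eqI)
    fix u
    have "(\<lambda>k. pmf (map_pmf fst (Js k)) u) \<longlonglongrightarrow> pmf (map_pmf fst J) u" by (rule tendsto_pmf_map[OF conv])
    then show "pmf (map_pmf fst J) u = pmf p u" unfolding marg by (simp add: LIMSEQ_const_iff)
  qed
  moreover have "E J f \<le> D" if "(f, D) \<in> C" for f D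
    using lim[OF that] LIMSEQ_unique[OF tendsto_expectation_finite[OF conv]] by metis
  ultimately show ?thesis by (auto simp: feasible_def)
qed

text \<open>A minimising sequence has a convergent subsequence, its limit is feasible, and
  \<open>cmi\<close> is continuous. Attainment matters because \<open>min_or_inf\<close> is defined
  by \<open>LEAST\<close>.\<close>

lemma ex_minimizer:
  fixes p :: "('x :: finite \<times> 'y :: finite) pmf" and C :: "((('x \<times> 'y) \<times> 'a :: finite \<Rightarrow> real) \<times> real) set"
  assumes "feasible p C \<noteq> {}"
  shows "\<exists>J\<in>feasible p C. \<forall>J'\<in>feasible p C. cmi J \<le> cmi J'"
proof -
  let ?I = "Inf (cmi ` feasible p C)"
  have bdd: "bdd_below (cmi ` feasible p C)"
    by (intro bdd_belowI[of _ 0]) (auto simp: cond_mutual_info_nonneg)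
  have "\<exists>J\<in>feasible p C. cmi J < ?I + 1 / Suc k" for k
  proof -
    have "?I < ?I + 1 / Suc k" by simp
    then show ?thesis using cInf_lessD[of "cmi ` feasible p C"] assms by blast
  qed
  then obtain Js where Js: "\<And>k. Js k \<in> feasible p C" "\<And>k. cmi (Js k) < ?I + 1 / Suc k" by metis
  obtain J r where r: "strict_mono r" and conv: "\<And>w. (\<lambda>k. pmf (Js (r k)) w) \<longlonglongrightarrow> pmf J w"
    using pmf_seq_compact[of Js] by blast
  have EJ: "E J f \<le> D" if "(f, D) \<in> C" for f D
  proof (rule LIMSEQ_le_const2[OF tendsto_expectation_finite[OF conv]])
    have "E (Js (r k)) f \<le> D" for k using Js(1)[of "r k"] that by (auto simp: feasible_def)
    then show "\<exists>N. \<forall>k\<ge>N. E (Js (r k)) f \<le> D" by blast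
  qed
  have J: "J \<in> feasible p C"
  proof (rule feasible_limit[OF conv])
    show "map_pmf fst (Js (r k)) = p" for k using Js(1)[of "r k"] by (simp add: feasible_def)
    show "\<exists>L\<le>D. (\<lambda>k. E (Js (r k)) f) \<longlonglongrightarrow> L" if "(f, D) \<in> C" for f D
      using EJ[OF that] tendsto_expectation_finite[OF conv] by blast
  qed
  have "(\<lambda>k. ?I + 1 / Suc (r k)) \<longlonglongrightarrow> ?I + 0"
    using LIMSEQ_subseq_LIMSEQ[OF LIMSEQ_inverse_real_of_nat r]
    by (intro tendsto_add tendsto_const) (simp add: o_def inverse_eq_divide)
  then have "cmi J \<le> ?I + 0"
    by (rule LIMSEQ_le[OF tendsto_cond_mutual_info[OF conv]]) (use Js(2) less_imp_le in blast)
  moreover have "?I \<le> cmi J'" if "J' \<in> feasible p C" for J'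
    using that by (intro cInf_lower bdd imageI)
  ultimately show ?thesis using J by force
qed

section \<open>The two minima as minima over feasible laws\<close>

lemma min_or_inf_eq_ereal:
  assumes "J \<in> S" "\<And>J'. J' \<in> S \<Longrightarrow> f J \<le> f J'"
  shows "min_or_inf (f ` S) = ereal (f J)"
proof -
  have "(LEAST v. v \<in> f ` S) = f J" using assms by (intro Least_equality) auto
  then show ?thesis using assms(1) by (auto simp: min_or_inf_def)
qed

lemma R_2d_eq:
  fixes P :: "('s :: finite \<times> 'x1 \<times> 'x2 \<times> 'y) pmf"
  shows "R_2d P d1 ds D1 Ds = min_or_inf (cmi ` feasible (map_pmf (\<lambda>v. (fst v, snd (snd v))) (map_pmf snd P))
     {(\<lambda>w. d1 (fst (fst w)) (fst (snd w)), D1), (\<lambda>w. ds' P ds (fst (fst w)) (snd (snd w)), Ds)})"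
proof -
  have m: "map_pmf (\<lambda>w. (X1_of w, Y_of w)) P = map_pmf (\<lambda>v. (fst v, snd (snd v))) (map_pmf snd P)"
    by (simp add: pmf.map_comp o_def of_eqs)
  have t: "(\<exists>W. J = test_joint p W) \<longleftrightarrow> map_pmf fst J = p" for J :: "('u \<times> 'v) pmf" and p
    using ex_test_joint[of J] map_fst_test_joint by metis
  show ?thesis
    unfolding R_2d_def m t feasible_def
    by (intro arg_cong[where f = min_or_inf]) (auto simp: case_prod_unfold image_def)
qed

lemma R_X2_eq:
  fixes P :: "('s :: finite \<times> 'x1 \<times> 'x2 \<times> 'y) pmf"
  shows "R_X2 P d2 D2 = min_or_inf (cmi ` feasible (map_pmf (\<lambda>v. (fst (snd v), snd (snd v))) (map_pmf snd P))
     {(\<lambda>w. d2 (fst (fst w)) (snd w), D2)})"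
proof -
  have m: "map_pmf (\<lambda>w. (X2_of w, Y_of w)) P = map_pmf (\<lambda>v. (fst (snd v), snd (snd v))) (map_pmf snd P)"
    by (simp add: pmf.map_comp o_def of_eqs)
  have t: "(\<exists>W. J = test_joint p W) \<longleftrightarrow> map_pmf fst J = p" for J :: "('u \<times> 'v) pmf" and p
    using ex_test_joint[of J] map_fst_test_joint by metis
  show ?thesis
    unfolding R_X2_def m t feasible_def
    by (intro arg_cong[where f = min_or_inf]) (auto simp: case_prod_unfold image_def)
qed

lemma pmf_merge: "pmf (map_pmf (\<lambda>w. (fst (fst w), snd w, snd (fst w))) (pair_pmf A B)) (a1, a2, b) = pmf A (a1, b) * pmf B a2"
proof -
  have "pmf (map_pmf (\<lambda>w. (fst (fst w), snd w, snd (fst w))) (pair_pmf A B)) ((\<lambda>w. (fst (fst w), snd w, snd (fst w))) ((a1, b), a2))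
     = pmf (pair_pmf A B) ((a1, b), a2)"
    by (rule pmf_map_inj') (auto simp: inj_on_def prod_eq_iff)
  then show ?thesis by (simp add: pmf_pair)
qed

lemma tendsto_mean_output_cong:
  assumes "(\<lambda>n. mean_output n p (\<phi> n) f) \<longlonglongrightarrow> L"
    and "\<And>n vs. n > 0 \<Longrightarrow> length vs = n \<Longrightarrow> \<psi> n vs = \<phi> n vs"
  shows "(\<lambda>n. mean_output n p (\<psi> n) f) \<longlonglongrightarrow> L"
proof (rule Lim_transform_eventually[OF assms(1)])
  show "\<forall>\<^sub>F n in sequentially. mean_output n p (\<phi> n) f = mean_output n p (\<psi> n) f"
    using eventually_gt_at_top[of 0]
    by eventually_elim (auto simp: mean_output_def assms(2) length_of_set_replicate_pmf intro!: expectation_cong_set_pmf)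
qed

text \<open>The two test channels run side by side: given (x1, x2, y), the pair (a1, b) comes from
  \<open>W1\<close> and a2 independently from \<open>W2\<close>; likewise the codeword letters come
  from \<open>q1\<close> and \<open>q2\<close> given y. The information densities add, so one
  codebook of triples at a rate above \<open>cmi J1 + cmi J2\<close> serves all three
  distortions.\<close>

lemma achievable_if_feasible:
  fixes P :: "('s :: finite \<times> 'x1 :: finite \<times> 'x2 :: finite \<times> 'y :: finite) pmf"
    and d1 :: "'x1 \<Rightarrow> 'a1 :: finite \<Rightarrow> real" and d2 :: "'x2 \<Rightarrow> 'a2 :: finite \<Rightarrow> real"
    and ds :: "'s \<Rightarrow> 'b :: finite \<Rightarrow> real"
  defines "p \<equiv> map_pmf snd P"
  assumes fact: "factorizes P" and D: "0 \<le> D1" "0 \<le> D2" "0 \<le> Ds"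
    and J1: "J1 \<in> feasible (map_pmf (\<lambda>v. (fst v, snd (snd v))) p)
      {(\<lambda>w. d1 (fst (fst w)) (fst (snd w)), D1), (\<lambda>w. ds' P ds (fst (fst w)) (snd (snd w)), Ds)}"
    and J2: "J2 \<in> feasible (map_pmf (\<lambda>v. (fst (snd v), snd (snd v))) p) {(\<lambda>w. d2 (fst (fst w)) (snd w), D2)}"
    and R: "cmi J1 + cmi J2 < R"
  shows "achievable P d1 d2 ds R D1 D2 Ds"
proof -
  let ?Y = "\<lambda>v :: 'x1 \<times> 'x2 \<times> 'y. snd (snd v)"
  let ?mrg = "\<lambda>w :: ('a1 \<times> 'b) \<times> 'a2. (fst (fst w), snd w, snd (fst w))"
  let ?p1 = "map_pmf (\<lambda>v. (fst v, snd (snd v))) p" and ?p2 = "map_pmf (\<lambda>v. (fst (snd v), snd (snd v))) p"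
  have R0: "0 \<le> R" using R cond_mutual_info_nonneg[of J1] cond_mutual_info_nonneg[of J2] by (meson add_nonneg_nonneg less_imp_le order_trans)
  obtain W1 where W1: "J1 = test_joint ?p1 W1" using J1 ex_test_joint[of J1] by (auto simp: feasible_def)
  obtain W2 where W2: "J2 = test_joint ?p2 W2" using J2 ex_test_joint[of J2] by (auto simp: feasible_def)
  have ex_q: "\<exists>q. map_pmf (\<lambda>w. (snd (fst w), snd w)) J = test_joint (map_pmf snd (map_pmf fst J)) q"
    for J :: "(('u \<times> 'v) \<times> 'w) pmf"
    using ex_test_joint[of "map_pmf (\<lambda>w. (snd (fst w), snd w)) J"] by (simp add: pmf.map_comp o_def)
  obtain q1 where q1: "map_pmf (\<lambda>w. (snd (fst w), snd w)) J1 = test_joint (map_pmf snd ?p1) q1"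
    using ex_q[of J1] J1 by (auto simp: feasible_def)
  obtain q2 where q2: "map_pmf (\<lambda>w. (snd (fst w), snd w)) J2 = test_joint (map_pmf snd ?p2) q2"
    using ex_q[of J2] J2 by (auto simp: feasible_def)
  define W where "W v = map_pmf ?mrg (pair_pmf (W1 (fst v, ?Y v)) (W2 (fst (snd v), ?Y v)))" for v
  define q where "q y = map_pmf ?mrg (pair_pmf (q1 y) (q2 y))" for y
  define i where "i w = log 2 (ratio J1 (proj1 w)) + log 2 (ratio J2 (proj2 w))" for w
  define J where "J = test_joint p W"
  \<comment> \<open>\<open>W1\<close> reads only x1 and y, so this projection involves only their
    marginal, and the law of a2 integrates out.\<close>
  have m1: "map_pmf proj1 J = J1"
  proof -
    have "map_pmf (\<lambda>w. ((x, y), fst (fst w), snd (fst w))) (pair_pmf A B) = map_pmf (Pair (x, y)) (map_pmf fst (pair_pmf A B))"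
      for x :: 'x1 and y :: 'y and A :: "('a1 \<times> 'b) pmf" and B :: "'a2 pmf" by (simp add: pmf.map_comp o_def)
    then show ?thesis
      by (simp add: J_def W_def W1 test_joint_def map_bind_pmf bind_map_pmf pmf.map_comp o_def proj1_def map_fst_pair_pmf)
  qed
  have m2: "map_pmf proj2 J = J2"
  proof -
    have "map_pmf (\<lambda>w. (u, snd w)) (pair_pmf A B) = map_pmf (Pair u) B"
      for u :: "'x2 \<times> 'y" and A :: "('a1 \<times> 'b) pmf" and B :: "'a2 pmf"
      using map_snd_pair_pmf[of A B, THEN arg_cong, where f = "map_pmf (Pair u)"] by (simp add: pmf.map_comp o_def)
    then show ?thesis
      by (simp add: J_def W_def W2 test_joint_def map_bind_pmf bind_map_pmf pmf.map_comp o_def proj2_def)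
  qed
  have E1: "E J (\<lambda>w. f (proj1 w)) = E J1 f" for f :: "_ \<Rightarrow> real" unfolding m1[symmetric] by simp
  have E2: "E J (\<lambda>w. f (proj2 w)) = E J2 f" for f :: "_ \<Rightarrow> real" unfolding m2[symmetric] by simp
  have Ei: "E J i = cmi J1 + cmi J2"
    unfolding i_def by (simp add: integrable_measure_pmf_finite E1[of "\<lambda>w. log 2 (ratio J1 w)"] E2[of "\<lambda>w. log 2 (ratio J2 w)"] cond_mutual_info_eq_expectation)
  have dom: "pmf (W v) a \<le> 2 powr i (v, a) * pmf (q (?Y v)) a" if v: "v \<in> set_pmf p" for v a
  proof -
    obtain x1 x2 y a1 a2 b where va: "v = (x1, x2, y)" "a = (a1, a2, b)" by (metis prod_cases3)
    have "(x1, y) \<in> set_pmf ?p1" "(x2, y) \<in> set_pmf ?p2" using v va by force+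
    note k = kernel_le_ratio[OF this(1) q1[unfolded W1], of "(a1, b)"] kernel_le_ratio[OF this(2) q2[unfolded W2], of a2]
    have "pmf (W v) a = pmf (W1 (x1, y)) (a1, b) * pmf (W2 (x2, y)) a2" by (simp add: W_def va pmf_merge)
    also have "\<dots> \<le> (2 powr log 2 (ratio J1 ((x1, y), (a1, b))) * pmf (q1 y) (a1, b)) *
        (2 powr log 2 (ratio J2 ((x2, y), a2)) * pmf (q2 y) a2)"
      using k unfolding W1[symmetric] W2[symmetric] by (intro mult_mono) auto
    also have "\<dots> = 2 powr i (v, a) * pmf (q (?Y v)) a"
      by (simp add: i_def q_def va pmf_merge proj1_def proj2_def powr_add)
    finally show ?thesis .
  qed
  let ?f1 = "\<lambda>w. d1 (fst (fst w)) (fst (snd w))" and ?f2 = "\<lambda>w. d2 (fst (snd (fst w))) (fst (snd (snd w)))"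
    and ?fs = "\<lambda>w. ds' P ds (fst (fst w)) (snd (snd (snd w)))"
  have "E (test_joint p W) i < R" using R Ei by (simp add: J_def)
  from covering[of p W i q ?Y "{?f1, ?f2, ?fs}", OF dom _ R0 this] obtain c \<phi> where
    c\<phi>: "\<forall>n>0. \<forall>ys. length ys = n \<longrightarrow> length (c n ys) = nat \<lfloor>2 powr (real n * R)\<rfloor> \<and> (\<forall>as\<in>set (c n ys). length as = n)"
      "\<forall>n>0. \<forall>vs. length vs = n \<longrightarrow> \<phi> n vs \<in> set (c n (map ?Y vs))"
      "\<forall>f\<in>{?f1, ?f2, ?fs}. (\<lambda>n. mean_output n p (\<phi> n) f) \<longlonglongrightarrow> E J f"
    unfolding J_def mean_output_def by blast
  have c: "length (c n ys) = nat \<lfloor>2 powr (real n * R)\<rfloor>" "\<And>as. as \<in> set (c n ys) \<Longrightarrow> length as = n"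
    if "n > 0" "length ys = n" for n ys using c\<phi>(1) that by blast+
  have \<phi>: "\<phi> n vs \<in> set (c n (map ?Y vs))" if "n > 0" "length vs = n" for n vs
    using c\<phi>(2) that by blast
  have lim: "(\<lambda>n. mean_output n p (\<phi> n) f) \<longlonglongrightarrow> E J f" if "f \<in> {?f1, ?f2, ?fs}" for f
    using c\<phi>(3) that by blast
  define idx where "idx n vs = (SOME j. j < length (c n (map ?Y vs)) \<and> c n (map ?Y vs) ! j = \<phi> n vs)" for n vs
  have idx: "idx n vs < length (c n (map ?Y vs)) \<and> c n (map ?Y vs) ! idx n vs = \<phi> n vs" if "n > 0" "length vs = n" for n vs
    unfolding idx_def using \<phi>[OF that] unfolding in_set_conv_nth by (rule someI_ex)
  \<comment> \<open>Messages start at 1 and list positions at 0, hence \<open>Suc\<close> here and m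
    - 1 in the decoder.\<close>
  define enc :: "nat \<Rightarrow> ('x1, 'x2, 'y) encoder" where
    "enc n = (\<lambda>(x1s, x2s, ys). Suc (idx n (zip x1s (zip x2s ys))))" for n
  define dec :: "nat \<Rightarrow> ('y, 'a1, 'a2, 'b) decoder" where
    "dec n = (\<lambda>(m, ys). (map fst (c n ys ! (m - 1)), map (\<lambda>a. fst (snd a)) (c n ys ! (m - 1)), map (\<lambda>a. snd (snd a)) (c n ys ! (m - 1))))" for n
  have code: "is_code n R (enc n) (dec n)" if n: "n > 0" for n
    unfolding is_code_def
  proof (intro conjI funcsetI)
    fix t :: "'x1 list \<times> 'x2 list \<times> 'y list" assume "t \<in> seqs n \<times> seqs n \<times> seqs n"
    then obtain x1s x2s ys where t: "t = (x1s, x2s, ys)" "length x1s = n" "length x2s = n" "length ys = n"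
      by (auto simp: seqs_def)
    have "map ?Y (zip x1s (zip x2s ys)) = map snd (map snd (zip x1s (zip x2s ys)))" by simp
    also have "\<dots> = ys" using t by (simp del: map_map)
    finally have Y: "map ?Y (zip x1s (zip x2s ys)) = ys" .
    have "idx n (zip x1s (zip x2s ys)) < nat \<lfloor>2 powr (real n * R)\<rfloor>"
      using idx[OF n, of "zip x1s (zip x2s ys)"] t c(1)[OF n, of ys] unfolding Y by simp
    then show "enc n t \<in> messages n R" unfolding enc_def t messages_def by simp
  next
    fix t :: "nat \<times> 'y list" assume "t \<in> messages n R \<times> seqs n"
    moreover obtain m ys where t0: "t = (m, ys)" by (cases t)
    ultimately have t: "1 \<le> m" "m \<le> nat \<lfloor>2 powr (real n * R)\<rfloor>" "length ys = n"
      by (simp_all add: messages_def seqs_def)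
    then have "m - 1 < length (c n ys)" unfolding c(1)[OF n t(3)] by linarith
    then have "length (c n ys ! (m - 1)) = n" by (intro c(2)[OF n t(3)] nth_mem)
    then show "dec n t \<in> seqs n \<times> seqs n \<times> seqs n" by (simp add: dec_def t0 seqs_def)
  qed
  have out: "code_output (enc n) (dec n) vs = \<phi> n vs" if n: "n > 0" "length vs = n" for n vs
  proof -
    have z: "zip (map fst l) (zip (map (\<lambda>v. fst (snd v)) l) (map (\<lambda>v. snd (snd v)) l)) = l" for l :: "('u \<times> 'v \<times> 'w) list"
      by (induction l) auto
    show ?thesis
      using idx[OF n] by (simp add: code_output_def enc_def dec_def z)
  qed
  have lim': "(\<lambda>n. mean_output n p (code_output (enc n) (dec n)) f) \<longlonglongrightarrow> E J f" if "f \<in> {?f1, ?f2, ?fs}" for f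
    by (rule tendsto_mean_output_cong[OF lim[OF that]]) (rule out)
  have ev: "\<forall>\<^sub>F n in sequentially. is_code n R (enc n) (dec n)"
    using eventually_gt_at_top[of 0] by eventually_elim (rule code)
  have tr: "A \<longlonglongrightarrow> E J f"
    if "f \<in> {?f1, ?f2, ?fs}" "\<And>n. is_code n R (enc n) (dec n) \<Longrightarrow> A n = mean_output n p (code_output (enc n) (dec n)) f" for A f
    by (rule Lim_transform_eventually[OF lim'[OF that(1)]]) (use ev in \<open>eventually_elim, simp add: that(2)\<close>)
  have b1: "E J ?f1 \<le> D1" "E J ?fs \<le> Ds" "E J ?f2 \<le> D2"
    using J1 J2 E1[of "\<lambda>w. d1 (fst (fst w)) (fst (snd w))"] E1[of "\<lambda>w. ds' P ds (fst (fst w)) (snd (snd w))"]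
      E2[of "\<lambda>w. d2 (fst (fst w)) (snd w)"]
    by (simp_all add: feasible_def proj1_def proj2_def)
  show ?thesis
    unfolding achievable_def
  proof (rule conjI[OF R0], rule conjI[OF D(1)], rule conjI[OF D(2)], rule conjI[OF D(3)], rule exI[of _ enc],
      rule exI[of _ dec], rule exI[of _ "E J ?f1"], rule exI[of _ "E J ?f2"], rule exI[of _ "E J ?fs"], intro conjI ev b1)
    show "(\<lambda>n. E (replicate_pmf n P) (\<lambda>ws. case reconstruct (enc n) (dec n) ws of (as1, as2, bs) \<Rightarrow>
        seq_dist d1 n (map X1_of ws) as1)) \<longlonglongrightarrow> E J ?f1"
      by (rule tr) (simp, unfold p_def, erule expectation_distortions(1)[OF fact])
    show "(\<lambda>n. E (replicate_pmf n P) (\<lambda>ws. case reconstruct (enc n) (dec n) ws of (as1, as2, bs) \<Rightarrow>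
        seq_dist d2 n (map X2_of ws) as2)) \<longlonglongrightarrow> E J ?f2"
      by (rule tr) (simp, unfold p_def, erule expectation_distortions(2)[OF fact])
    show "(\<lambda>n. E (replicate_pmf n P) (\<lambda>ws. case reconstruct (enc n) (dec n) ws of (as1, as2, bs) \<Rightarrow>
        seq_dist ds n (map S_of ws) bs)) \<longlonglongrightarrow> E J ?fs"
      by (rule tr) (simp, unfold p_def, erule expectation_distortions(3)[OF fact])
  qed
qed

text \<open>One subsequence is extracted for the averaged laws of all letters together. Both
  projections converge along it, so the bound on the sum of the two informations passes to the
  limit.\<close>

lemma feasible_if_achievable:
  fixes P :: "('s :: finite \<times> 'x1 :: finite \<times> 'x2 :: finite \<times> 'y :: finite) pmf"
    and d1 :: "'x1 \<Rightarrow> 'a1 :: finite \<Rightarrow> real" and d2 :: "'x2 \<Rightarrow> 'a2 :: finite \<Rightarrow> real"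
    and ds :: "'s \<Rightarrow> 'b :: finite \<Rightarrow> real"
  defines "p \<equiv> map_pmf snd P"
  assumes fact: "factorizes P" and markov: "markov_chain P X1_of Y_of X2_of"
    and ach: "achievable P d1 d2 ds R D1 D2 Ds"
  shows "\<exists>J1 \<in> feasible (map_pmf (\<lambda>v. (fst v, snd (snd v))) p)
      {(\<lambda>w. d1 (fst (fst w)) (fst (snd w)), D1), (\<lambda>w. ds' P ds (fst (fst w)) (snd (snd w)), Ds)}.
    \<exists>J2 \<in> feasible (map_pmf (\<lambda>v. (fst (snd v), snd (snd v))) p) {(\<lambda>w. d2 (fst (fst w)) (snd w), D2)}.
      cmi J1 + cmi J2 \<le> R"
proof -
  obtain enc :: "nat \<Rightarrow> ('x1, 'x2, 'y) encoder" and dec :: "nat \<Rightarrow> ('y, 'a1, 'a2, 'b) decoder" and L1 L2 Ls where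
    R: "0 \<le> R" and ev: "\<forall>\<^sub>F n in sequentially. is_code n R (enc n) (dec n)" and
    L: "(\<lambda>n. E (replicate_pmf n P) (\<lambda>ws. case reconstruct (enc n) (dec n) ws of (as1, as2, bs) \<Rightarrow>
             seq_dist d1 n (map X1_of ws) as1)) \<longlonglongrightarrow> L1" "L1 \<le> D1"
       "(\<lambda>n. E (replicate_pmf n P) (\<lambda>ws. case reconstruct (enc n) (dec n) ws of (as1, as2, bs) \<Rightarrow>
             seq_dist d2 n (map X2_of ws) as2)) \<longlonglongrightarrow> L2" "L2 \<le> D2"
       "(\<lambda>n. E (replicate_pmf n P) (\<lambda>ws. case reconstruct (enc n) (dec n) ws of (as1, as2, bs) \<Rightarrow>
             seq_dist ds n (map S_of ws) bs)) \<longlonglongrightarrow> Ls" "Ls \<le> Ds"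
    using ach unfolding achievable_def by blast
  obtain N where N: "\<And>n. n \<ge> N \<Longrightarrow> is_code n R (enc n) (dec n)"
    using ev unfolding eventually_sequentially by blast
  \<comment> \<open>The shift by \<open>Suc N\<close> skips the lengths at which there need not be a
    code, and also n = 0.\<close>
  define s where "s k = k + Suc N" for k
  have s: "strict_mono s" by (simp add: s_def strict_mono_def)
  have code: "is_code (s k) R (enc (s k)) (dec (s k))" and pos: "0 < s k" for k
    using N[of "s k"] by (simp_all add: s_def)
  define K where "K k = avg_joint (s k) p (code_output (enc (s k)) (dec (s k)))" for k
  have len: "length (code_output (enc (s k)) (dec (s k)) vs) = s k" if "length vs = s k" for k vs
    by (rule length_code_output[OF code that])
  have EK: "E (K k) f = mean_output (s k) p (code_output (enc (s k)) (dec (s k))) f" for k f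
    unfolding K_def mean_output_def by (rule expectation_avg_joint[OF pos len])
  have mK: "map_pmf fst (K k) = p" for k
    unfolding K_def by (rule map_fst_avg_joint[OF pos len])
  have I: "cmi (map_pmf proj1 (K k)) + cmi (map_pmf proj2 (K k)) \<le> R" for k
    unfolding K_def by (rule converse_single[OF pos R code markov_chain_pmf[OF markov, folded p_def]])
  have lim: "(\<lambda>k. E (K k) (\<lambda>w. d1 (fst (fst w)) (fst (snd w)))) \<longlonglongrightarrow> L1"
    "(\<lambda>k. E (K k) (\<lambda>w. d2 (fst (snd (fst w))) (fst (snd (snd w))))) \<longlonglongrightarrow> L2"
    "(\<lambda>k. E (K k) (\<lambda>w. ds' P ds (fst (fst w)) (snd (snd (snd w))))) \<longlonglongrightarrow> Ls"
    using LIMSEQ_subseq_LIMSEQ[OF L(1) s] LIMSEQ_subseq_LIMSEQ[OF L(3) s] LIMSEQ_subseq_LIMSEQ[OF L(5) s]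
    unfolding o_def expectation_distortions[OF fact code] EK p_def .
  obtain J r where r: "strict_mono r" and conv: "\<And>w. (\<lambda>k. pmf (K (r k)) w) \<longlonglongrightarrow> pmf J w"
    using pmf_seq_compact[of K] by blast
  note lim_r = LIMSEQ_subseq_LIMSEQ[OF lim(1) r, unfolded o_def] LIMSEQ_subseq_LIMSEQ[OF lim(2) r, unfolded o_def]
    LIMSEQ_subseq_LIMSEQ[OF lim(3) r, unfolded o_def]
  have mp: "map_pmf (\<lambda>w. f (fst w)) (K k) = map_pmf f p" for f :: "'x1 \<times> 'x2 \<times> 'y \<Rightarrow> 'z" and k
    using arg_cong[OF mK, where f = "map_pmf f"] by (simp add: pmf.map_comp o_def)
  have c1: "(\<lambda>k. pmf (map_pmf proj1 (K (r k))) w) \<longlonglongrightarrow> pmf (map_pmf proj1 J) w" for w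
    by (rule tendsto_pmf_map[OF conv])
  have c2: "(\<lambda>k. pmf (map_pmf proj2 (K (r k))) w) \<longlonglongrightarrow> pmf (map_pmf proj2 J) w" for w
    by (rule tendsto_pmf_map[OF conv])
  show ?thesis
  proof (intro bexI)
    show "cmi (map_pmf proj1 J) + cmi (map_pmf proj2 J) \<le> R"
      using I by (intro LIMSEQ_le_const2[OF tendsto_add[OF tendsto_cond_mutual_info[OF c1] tendsto_cond_mutual_info[OF c2]]]) blast
    show "map_pmf proj2 J \<in> feasible (map_pmf (\<lambda>v. (fst (snd v), snd (snd v))) p) {(\<lambda>w. d2 (fst (fst w)) (snd w), D2)}"
    proof (rule feasible_limit[OF c2])
      show "map_pmf fst (map_pmf proj2 (K (r k))) = map_pmf (\<lambda>v. (fst (snd v), snd (snd v))) p" for k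
        using mp[of "\<lambda>v. (fst (snd v), snd (snd v))"] by (simp add: pmf.map_comp o_def proj2_def)
    qed (use lim_r L in \<open>auto simp: proj2_def\<close>)
    show "map_pmf proj1 J \<in> feasible (map_pmf (\<lambda>v. (fst v, snd (snd v))) p)
      {(\<lambda>w. d1 (fst (fst w)) (fst (snd w)), D1), (\<lambda>w. ds' P ds (fst (fst w)) (snd (snd w)), Ds)}"
    proof (rule feasible_limit[OF c1])
      show "map_pmf fst (map_pmf proj1 (K (r k))) = map_pmf (\<lambda>v. (fst v, snd (snd v))) p" for k
        using mp[of "\<lambda>v. (fst v, snd (snd v))"] by (simp add: pmf.map_comp o_def proj1_def)
    qed (use lim_r L in \<open>auto simp: proj1_def\<close>)
  qed
qed

theorem lemma3:
  fixes P :: "('s :: finite \<times> 'x1 :: finite \<times> 'x2 :: finite \<times> 'y :: finite) pmf"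
    and d1 :: "'x1 \<Rightarrow> 'a1 :: finite \<Rightarrow> real"
    and d2 :: "'x2 \<Rightarrow> 'a2 :: finite \<Rightarrow> real"
    and ds :: "'s \<Rightarrow> 'b :: finite \<Rightarrow> real"
    and D1 D2 Ds :: real
  assumes "factorizes P"
    and "\<And>x a. 0 \<le> d1 x a"
    and "\<And>x a. 0 \<le> d2 x a"
    and "\<And>s b. 0 \<le> ds s b"
    and "0 \<le> D1" and "0 \<le> D2" and "0 \<le> Ds"
    and "markov_chain P X1_of Y_of X2_of"
  shows "rate_distortion P d1 d2 ds D1 D2 Ds = R_2d P d1 ds D1 Ds + R_X2 P d2 D2"
proof -
  define S1 where "S1 = feasible (map_pmf (\<lambda>v. (fst v, snd (snd v))) (map_pmf snd P))
      {(\<lambda>w. d1 (fst (fst w)) (fst (snd w)), D1), (\<lambda>w. ds' P ds (fst (fst w)) (snd (snd w)), Ds)}"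
  define S2 where "S2 = feasible (map_pmf (\<lambda>v. (fst (snd v), snd (snd v))) (map_pmf snd P))
      {(\<lambda>w. d2 (fst (fst w)) (snd w), D2)}"
  have conv: "\<exists>J1\<in>S1. \<exists>J2\<in>S2. cmi J1 + cmi J2 \<le> R" if "achievable P d1 d2 ds R D1 D2 Ds" for R
    unfolding S1_def S2_def by (rule feasible_if_achievable[OF assms(1,8) that])
  have ach: "achievable P d1 d2 ds R D1 D2 Ds" if "J1 \<in> S1" "J2 \<in> S2" "cmi J1 + cmi J2 < R" for J1 J2 R
    using achievable_if_feasible[OF assms(1,5,6,7) that(1)[unfolded S1_def] that(2)[unfolded S2_def] that(3)] .
  have RHS: "R_2d P d1 ds D1 Ds = min_or_inf (cmi ` S1)" "R_X2 P d2 D2 = min_or_inf (cmi ` S2)"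
    unfolding S1_def S2_def by (rule R_2d_eq R_X2_eq)+
  show ?thesis
  proof (cases "S1 = {} \<or> S2 = {}")
    case True
    \<comment> \<open>Both sides are \<infinity>: the infimum is over no rates, and as
      \<open>min_or_inf\<close> is never -\<infinity>, one infinite summand suffices.\<close>
    then have "{R. achievable P d1 d2 ds R D1 D2 Ds} = {}" using conv by blast
    moreover have "min_or_inf (cmi ` S1) + min_or_inf (cmi ` S2) = \<infinity>"
      using True by (auto simp: min_or_inf_def)
    ultimately show ?thesis unfolding RHS rate_distortion_def by (simp add: top_ereal_def)
  next
    case False
    obtain J1 where J1: "J1 \<in> S1" "\<And>J'. J' \<in> S1 \<Longrightarrow> cmi J1 \<le> cmi J'"
      using ex_minimizer False unfolding S1_def by blast
    obtain J2 where J2: "J2 \<in> S2" "\<And>J'. J' \<in> S2 \<Longrightarrow> cmi J2 \<le> cmi J'"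
      using ex_minimizer False unfolding S2_def by blast
    have "rate_distortion P d1 d2 ds D1 D2 Ds = ereal (cmi J1 + cmi J2)"
      unfolding rate_distortion_def
    proof (rule antisym)
      show "ereal (cmi J1 + cmi J2) \<le> (INF R\<in>{R. achievable P d1 d2 ds R D1 D2 Ds}. ereal R)"
        using conv J1(2) J2(2) by (intro INF_greatest) (force intro: order_trans add_mono)
      show "(INF R\<in>{R. achievable P d1 d2 ds R D1 D2 Ds}. ereal R) \<le> ereal (cmi J1 + cmi J2)"
      \<comment> \<open>Codes are available only at rates strictly above the sum, hence the slack
        \<open>e\<close>.\<close>
      proof (rule ereal_le_epsilon2)
        fix e :: real assume "0 < e"
        then have "achievable P d1 d2 ds (cmi J1 + cmi J2 + e) D1 D2 Ds" using ach[OF J1(1) J2(1)] by simp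
        then show "(INF R\<in>{R. achievable P d1 d2 ds R D1 D2 Ds}. ereal R) \<le> ereal (cmi J1 + cmi J2) + ereal e"
          by (intro INF_lower2[where i = "cmi J1 + cmi J2 + e"]) auto
      qed
    qed
    moreover have "min_or_inf (cmi ` S1) = ereal (cmi J1)"
      by (rule min_or_inf_eq_ereal[OF J1(1)]) (rule J1(2))
    moreover have "min_or_inf (cmi ` S2) = ereal (cmi J2)"
      by (rule min_or_inf_eq_ereal[OF J2(1)]) (rule J2(2))
    ultimately show ?thesis unfolding RHS by simp
  qed
qed

end
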